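(* Let $M$ be a loopless matroid (on a finite ground set) of rank $d\geq 3$, with $h$-vector $(h_0(M),h_1(M),\ldots,h_d(M))$. Then the vector $(1,h_1(M),h_2(M),h_3(M))$ is a pure $O$-sequence.
   Context: A matroid $M=(E(M),\mathcal{I}(M))$ has a finite ground set $E(M)$ and family of independent sets $\mathcal{I}(M)\subseteq 2^{E(M)}$; its rank is the cardinality of a maximal independent set (a basis). A loop is an element $e\in E(M)$ with $\{e\}\notin\mathcal{I}(M)$; $M$ is loopless if it has no loops. If $M$ has rank $d$, its $f$-vector is $(f_{-1}(M),f_0(M),\ldots,f_{d-1}(M))$ with $f_{i-1}(M)=|\{A\in\mathcal{I}(M): |A|=i\}|$. Its $h$-vector $h(M)=(h_0(M),\ldots,h_d(M))$ is defined by the polynomial identity in $\lambda$ $$\sum_{j=0}^d h_j(M)\lambda^j=\sum_{i=0}^d f_{i-1}(M)\lambda^i(1-\lambda)^{d-i}.$$ An order ideal $\mathcal{O}$ is a nonempty family of monomials (in finitely many variables) of degree at most some $r$, such that if $\mu\in\mathcal{O}$ and $\nu\mid\mu$ then $\nu\in\mathcal{O}$. Put $F_i(\mathcal{O})=$ the number of monomials of degree $i$ in $\mathcal{O}$ and $F(\mathcal{O})=(F_0(\mathcal{O}),\ldots,F_r(\mathcal{O}))$; trailing entries are allowed to be zero. $\mathcal{O}$ is pure if all of its maximal monomials under divisibility have the same degree. A vector $(a_0,a_1,\ldots,a_r)$ is a pure $O$-sequence if there is a pure order ideal $\mathcal{O}$ of monomials of degree at most $r$ with $a_i=F_i(\mathcal{O})$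 for all $0\le i\le r$. *)

theory Defs
  imports "HOL-Library.Multiset" "HOL-Computational_Algebra.Polynomial"
begin

section \<open>Matroids\<close>

locale matroid =
  fixes E :: "'a set" and I :: "'a set set"
  assumes finite_ground: "finite E"
    and indep_subset_ground: "A \<in> I \<Longrightarrow> A \<subseteq> E"
    and indep_empty: "{} \<in> I"
    and indep_subset: "A \<in> I \<Longrightarrow> B \<subseteq> A \<Longrightarrow> B \<in> I"
    and indep_exchange:
      "A \<in> I \<Longrightarrow> B \<in> I \<Longrightarrow> card A < card B \<Longrightarrow> \<exists>x\<in>B - A. insert x A \<in> I"

definition basis :: "'a set set \<Rightarrow> 'a set \<Rightarrow> bool" where
  "basis I B \<longleftrightarrow> B \<in> I \<and> (\<forall>A\<in>I. B \<subseteq> A \<longrightarrow> A = B)"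

text \<open>Well defined for matroids: see \<open>ex_basis\<close> and \<open>rank_eq_card_basis\<close> below.\<close>

definition rank :: "'a set set \<Rightarrow> nat" where
  "rank I = (THE r. \<exists>B. basis I B \<and> card B = r)"

definition is_loop :: "'a set \<Rightarrow> 'a set set \<Rightarrow> 'a \<Rightarrow> bool" where
  "is_loop E I e \<longleftrightarrow> e \<in> E \<and> {e} \<notin> I"

definition loopless :: "'a set \<Rightarrow> 'a set set \<Rightarrow> bool" where
  "loopless E I \<longleftrightarrow> (\<forall>e. \<not> is_loop E I e)"

context matroid
begin

lemma ex_basis: "\<exists>B. basis I B"
proof -
  have "finite I"
    by (rule finite_subset[of I "Pow E"]) (auto simp: finite_ground dest: indep_subset_ground)
  then obtain B where "B \<in> I" "\<forall>A\<in>I. B \<le> A \<longrightarrow> B = A"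
    using finite_has_maximal[of I] indep_empty by blast
  then show ?thesis by (auto simp: basis_def)
qed

lemma card_basis_le:
  assumes "basis I B" "A \<in> I"
  shows "card A \<le> card B"
proof (rule ccontr)
  assume "\<not> card A \<le> card B"
  then obtain x where "x \<in> A - B" "insert x B \<in> I"
    using indep_exchange[of B A] assms by (auto simp: basis_def)
  then have "insert x B = B"
    using assms(1) unfolding basis_def by blast
  with \<open>x \<in> A - B\<close> show False by blast
qed

lemma rank_eq_card_basis:
  assumes "basis I B"
  shows "rank I = card B"
proof -
  have "card B' = card B" if "basis I B'" for B'
    using card_basis_le[OF assms] card_basis_le[OF that] assms that
    by (simp add: basis_def le_antisym)
  then show ?thesis
    unfolding rank_def using assms by (intro the_equality) blast+
qed

end


section \<open>The $f$-vector and the $h$-vector\<close>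

text \<open>Indexed by cardinality: \<open>f_count I i\<close> is the entry usually written $f_{i-1}$.\<close>

definition f_count :: "'a set set \<Rightarrow> nat \<Rightarrow> nat" where
  "f_count I i = card {A \<in> I. card A = i}"

text \<open>The right-hand side of the defining identity, with \<open>[:0, 1:]\<close> for $\lambda$
  and \<open>[:1, -1:]\<close> for $1 - \lambda$.\<close>

definition h_poly :: "'a set set \<Rightarrow> int poly" where
  "h_poly I =
    (\<Sum>i\<le>rank I. of_nat (f_count I i) * [:0, 1:] ^ i * [:1, -1:] ^ (rank I - i))"

definition h_vec :: "'a set set \<Rightarrow> nat \<Rightarrow> int" where
  "h_vec I j = coeff (h_poly I) j"


section \<open>Pure O-sequences\<close>

text \<open>A monomial is the multiset of its variables, so that \<open>\<subseteq>#\<close> is divisibility and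
  \<open>size\<close> is the degree.\<close>

definition order_ideal :: "nat \<Rightarrow> 'v multiset set \<Rightarrow> bool" where
  "order_ideal r \<O> \<longleftrightarrow>
    \<O> \<noteq> {} \<and>
    finite (\<Union>\<mu>\<in>\<O>. set_mset \<mu>) \<and>
    (\<forall>\<mu>\<in>\<O>. size \<mu> \<le> r) \<and>
    (\<forall>\<mu>\<in>\<O>. \<forall>\<nu>. \<nu> \<subseteq># \<mu> \<longrightarrow> \<nu> \<in> \<O>)"

definition degree_count :: "'v multiset set \<Rightarrow> nat \<Rightarrow> nat" where
  "degree_count \<O> i = card {\<mu> \<in> \<O>. size \<mu> = i}"

definition maximal_monomial :: "'v multiset set \<Rightarrow> 'v multiset \<Rightarrow> bool" where
  "maximal_monomial \<O> \<mu> \<longleftrightarrow> \<mu> \<in> \<O> \<and> (\<forall>\<nu>\<in>\<O>. \<mu> \<subseteq># \<nu> \<longrightarrow> \<nu> = \<mu>)"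

definition pure :: "'v multiset set \<Rightarrow> bool" where
  "pure \<O> \<longleftrightarrow>
    (\<forall>\<mu> \<nu>. maximal_monomial \<O> \<mu> \<longrightarrow> maximal_monomial \<O> \<nu> \<longrightarrow> size \<mu> = size \<nu>)"

text \<open>The list \<open>[a\<^sub>0, \<dots>, a\<^sub>r]\<close> encodes the vector. Variables are named by natural
  numbers, which is no restriction as an order ideal involves only finitely many.\<close>

definition pure_O_sequence :: "int list \<Rightarrow> bool" where
  "pure_O_sequence a \<longleftrightarrow>
    a \<noteq> [] \<and>
    (\<exists>\<O> :: nat multiset set. order_ideal (length a - 1) \<O> \<and> pure \<O> \<and>
      (\<forall>i<length a. a ! i = int (degree_count \<O> i)))"

end

theory Submission
  imports Defs "HOL-Computational_Algebra.Formal_Power_Series"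
begin

text \<open>
Let \<open>P\<close> contain one element of every parallel class of the matroid, so that the restriction to \<open>P\<close> is
a simple matroid of the same rank \<open>d\<close>, and write \<open>card P = d + k\<close>. Let \<open>X\<close> consist of the \<open>k\<close> elements
of \<open>P\<close> outside some basis, and let \<open>Y = E - P\<close>. An independent set is determined by its part \<open>y\<close> in
\<open>Y\<close>, a partial transversal of the parallel classes, together with the set of representatives of its
elements. Summing over \<open>y\<close> and applying Vandermonde's identity for each \<open>y\<close> separately gives, for
\<open>j \<le> 3\<close>,

  \<open>h\<^sub>j = (\<Sum>y. number of monomials of degree j - |y| in the variables X - (if j = 3 then D(y) else 0))\<close>,

where \<open>D(y)\<close> counts the dependent triples of \<open>P\<close> that contain the representatives of \<open>y\<close>
(\<open>h_vec_eq_sum_transversals\<close>). So the monomials to take are the products \<open>y m\<close> with \<open>y\<close> a partial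
transversal and \<open>m\<close> a monomial in \<open>X\<close>: all of them in degrees up to 2, and in degree 3, for each \<open>y\<close>,
all but \<open>D(y)\<close> of them. Whatever is left out, the result is an order ideal with the right degree counts;
the omitted cubics have to be chosen so that it is pure.

If \<open>k > 0\<close> and every line of \<open>P\<close> has at most \<open>k + 1\<close> points, then there are few dependent triples: at most
\<open>(k + 1) choose 3\<close> in total, \<open>k choose 2\<close> through a point and \<open>k - 1\<close> through a pair of points, except that
for \<open>k \<ge> 2\<close> the first two bounds increase by 1 (\<open>card_dep_triples_containing\<close>). By Pascal's rule, for each
\<open>y\<close> at least as many cubics \<open>y m\<close> may be kept as there are quadratic monomials \<open>y m'\<close>, or one less. These suffice to
cover all the quadratic ones: multiply each \<open>m'\<close> by one fixed variable \<open>x\<close>, and drop the pure power of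
\<open>x\<close>, which also divides a multiple of another monomial (\<open>small_cover\<close>). Hence all maximal monomials are
cubics.

If \<open>k > 0\<close> and some line \<open>L\<close> has \<open>k + 2\<close> points, which is the most possible, then \<open>P\<close> is the direct sum of \<open>L\<close> and
coloops, and the dependent triples are those inside \<open>L\<close>. The formula then asks for no cubic \<open>y m\<close> when \<open>y\<close>
is parallel into \<open>L\<close>, and for all of them otherwise. If no \<open>y\<close> leaves \<open>L\<close>, all maximal monomials are
quadratic; an element of \<open>Y\<close> off \<open>L\<close> on the other hand extends every quadratic \<open>y m\<close> with \<open>y\<close> on \<open>L\<close> to a
cubic, and the other quadratic monomials may be multiplied by any variable in \<open>X\<close>. Finally, if \<open>k = 0\<close>, there are no variables \<open>X\<close>, and the order ideal is the complex of partial
transversals of size at most 3.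
\<close>

section \<open>Augmentation and restriction\<close>

context matroid
begin

lemma finite_indep: "A \<in> I \<Longrightarrow> finite A"
  using finite_ground finite_subset indep_subset_ground by blast

lemma card_indep_le_rank: "A \<in> I \<Longrightarrow> card A \<le> rank I"
  using ex_basis card_basis_le rank_eq_card_basis by metis

lemma augment:
  assumes "A \<in> I" "B \<in> I" "card A \<le> card B"
  obtains C where "C \<subseteq> B - A" "A \<union> C \<in> I" "card (A \<union> C) = card B"
proof -
  have "\<exists>C. C \<subseteq> B - A \<and> A \<union> C \<in> I \<and> card (A \<union> C) = card B"
    using assms(1,3)
  proof (induction "card B - card A" arbitrary: A)
    case 0
    then show ?case by (intro exI[of _ "{}"]) auto
  next
    case (Suc n)
    then obtain x where x: "x \<in> B - A" "insert x A \<in> I"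
      using indep_exchange[of A B] assms(2) by (metis zero_less_Suc zero_less_diff)
    have fin: "finite A" using Suc.prems finite_indep by blast
    have "n = card B - card (insert x A)" "card (insert x A) \<le> card B"
      using Suc.hyps(2) x fin by auto
    from Suc.hyps(1)[OF this(1) x(2) this(2)]
    obtain C where "C \<subseteq> B - insert x A" "insert x A \<union> C \<in> I" "card (insert x A \<union> C) = card B"
      by blast
    then show ?case using x by (intro exI[of _ "insert x C"]) auto
  qed
  then show ?thesis using that by blast
qed

lemma basis_iff_card: "basis I B \<longleftrightarrow> B \<in> I \<and> card B = rank I"
proof
  assume "basis I B"
  then show "B \<in> I \<and> card B = rank I"
    using rank_eq_card_basis by (auto simp: basis_def)
next
  assume B: "B \<in> I \<and> card B = rank I"
  have "A = B" if "A \<in> I" "B \<subseteq> A" for A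
    using card_indep_le_rank[OF that(1)] that B finite_indep[OF that(1)]
    by (metis card_seteq)
  then show "basis I B" using B by (auto simp: basis_def)
qed

lemma extend_to_basis:
  assumes "A \<in> I"
  obtains B where "A \<subseteq> B" "B \<in> I" "card B = rank I"
proof -
  obtain B0 where B0: "basis I B0" using ex_basis by blast
  then have "B0 \<in> I" "card B0 = rank I" by (auto simp: basis_iff_card)
  with augment[OF assms \<open>B0 \<in> I\<close>] card_indep_le_rank[OF assms]
  show ?thesis using that by (metis Un_upper1)
qed

lemma matroid_restrict: "P \<subseteq> E \<Longrightarrow> matroid P {A \<in> I. A \<subseteq> P}"
proof (unfold_locales, goal_cases)
  case 1 then show ?case using finite_ground finite_subset by blast
next
  case (5 A B)
  then show ?case using indep_exchange[of A B] by auto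
qed (use indep_empty indep_subset in auto)

lemma rank_restrict:
  assumes "P \<subseteq> E" "B \<in> I" "B \<subseteq> P" "card B = rank I"
  shows "rank {A \<in> I. A \<subseteq> P} = rank I"
proof -
  interpret R: matroid P "{A \<in> I. A \<subseteq> P}" using matroid_restrict assms(1) .
  have "basis {A \<in> I. A \<subseteq> P} B"
    using assms basis_iff_card[of B] by (auto simp: basis_def)
  then show ?thesis using R.rank_eq_card_basis assms by simp
qed

end

section \<open>Lines in a simple matroid\<close>

locale simple_matroid = matroid +
  assumes pair_indep: "x \<in> E \<Longrightarrow> y \<in> E \<Longrightarrow> {x, y} \<in> I"

text \<open>
The points \<open>x\<close> and \<open>y\<close> are listed separately, since \<open>{x, y, z}\<close> is an independent pair when \<open>z\<close> is one of them.
\<close>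

definition line :: "'a set \<Rightarrow> 'a set set \<Rightarrow> 'a \<Rightarrow> 'a \<Rightarrow> 'a set" where
  "line E I x y = {z \<in> E. z = x \<or> z = y \<or> {x, y, z} \<notin> I}"

definition dep_triples :: "'a set \<Rightarrow> 'a set set \<Rightarrow> 'a set \<Rightarrow> 'a set set" where
  "dep_triples E I S = {T. S \<subseteq> T \<and> T \<subseteq> E \<and> card T = 3 \<and> T \<notin> I}"

lemma finite_dep_triples: "finite E \<Longrightarrow> finite (dep_triples E I S)"
  by (rule finite_subset[of _ "Pow E"]) (auto simp: dep_triples_def)

context simple_matroid
begin

lemma small_indep: "S \<subseteq> E \<Longrightarrow> card S \<le> 2 \<Longrightarrow> S \<in> I"
proof -
  assume S: "S \<subseteq> E" "card S \<le> 2"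
  then have fin: "finite S" using finite_ground finite_subset by blast
  consider "card S = 0" | "card S = 1" | "card S = 2" using S by linarith
  then show "S \<in> I"
  proof cases
    case 1
    then show ?thesis using fin indep_empty by simp
  next
    case 2
    then obtain x where "S = {x}" using card_1_singletonE by blast
    then show ?thesis using pair_indep[of x x] S by simp
  next
    case 3
    then obtain x y where "S = {x, y}" by (auto simp: card_2_iff)
    then show ?thesis using pair_indep S by simp
  qed
qed

lemma line_subset: "line E I x y \<subseteq> E"
  by (auto simp: line_def)

lemma finite_line: "finite (line E I x y)"
  using finite_ground finite_subset line_subset by blast

lemma ends_in_line: "x \<in> E \<Longrightarrow> y \<in> E \<Longrightarrow> {x, y} \<subseteq> line E I x y"
  by (auto simp: line_def)

lemma line_triple_dep:
  assumes "x \<in> E" "y \<in> E" "x \<noteq> y" "T \<subseteq> line E I x y" "card T = 3"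
  shows "T \<notin> I"
proof
  assume "T \<in> I"
  moreover have "card {x, y} < card T" using assms by simp
  ultimately obtain z where "z \<in> T - {x, y}" "insert z {x, y} \<in> I"
    using indep_exchange[of "{x, y}" T] pair_indep assms by blast
  then show False using assms(4) by (auto simp: line_def insert_commute)
qed

lemma line_closed:
  assumes "x \<in> E" "y \<in> E" "x \<noteq> y" "a \<in> line E I x y" "b \<in> line E I x y" "a \<noteq> b"
    and "e \<in> E" "{a, b, e} \<notin> I"
  shows "e \<in> line E I x y"
proof (rule ccontr)
  assume e: "e \<notin> line E I x y"
  then have ne: "e \<noteq> x" "e \<noteq> y" "{x, y, e} \<in> I"
    using assms by (auto simp: line_def)
  have "a \<in> E" "b \<in> E" using assms line_subset by auto
  then have "{a, b} \<in> I" by (rule pair_indep)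
  moreover have "card {a, b} < card {x, y, e}" using assms ne by simp
  ultimately obtain z where z: "z \<in> {x, y, e} - {a, b}" "insert z {a, b} \<in> I"
    using indep_exchange[of "{a, b}" "{x, y, e}"] ne by blast
  then have "z \<noteq> e" using assms(8) by (auto simp: insert_commute)
  then have "{z, a, b} \<subseteq> line E I x y" "card {z, a, b} = 3"
    using z assms ends_in_line[of x y] by auto
  then show False using line_triple_dep[of x y] assms z by metis
qed

lemma line_unique:
  assumes "x \<in> E" "y \<in> E" "x \<noteq> y" "a \<in> line E I x y" "b \<in> line E I x y" "a \<noteq> b"
  shows "line E I a b = line E I x y"
proof
  show "line E I a b \<subseteq> line E I x y"
    using line_closed[OF assms] assms(4,5) by (auto simp: line_def[of E I a b])
  show "line E I x y \<subseteq> line E I a b"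
  proof
    fix z assume z: "z \<in> line E I x y"
    have "{a, b, z} \<notin> I" if "z \<noteq> a" "z \<noteq> b"
      using line_triple_dep[OF assms(1-3), of "{a, b, z}"] z assms that by auto
    then show "z \<in> line E I a b" using z by (auto simp: line_def)
  qed
qed

lemma line_Int_indep:
  assumes "B \<in> I" "{x, y} \<subseteq> B"
  shows "B \<inter> line E I x y = {x, y}"
proof -
  have "z \<in> {x, y}" if "z \<in> B" "z \<in> line E I x y" for z
    using that assms indep_subset[of B "{x, y, z}"] by (auto simp: line_def)
  moreover have "{x, y} \<subseteq> line E I x y"
    using assms indep_subset_ground by (intro ends_in_line) auto
  ultimately show ?thesis using assms by auto
qed

lemma card_line_Un_basis:
  assumes "B \<in> I" "{x, y} \<subseteq> B" "x \<noteq> y" "card B = rank I"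
  shows "card (line E I x y \<union> B) + 2 = card (line E I x y) + rank I"
    "line E I x y \<union> B \<subseteq> E"
proof -
  have "card (line E I x y \<inter> B) = 2"
    using line_Int_indep[OF assms(1,2)] assms(3) by (simp add: Int_commute)
  then show "card (line E I x y \<union> B) + 2 = card (line E I x y) + rank I"
    using card_Un_Int[OF finite_line finite_indep[OF assms(1)], of x y] assms(4) by simp
  show "line E I x y \<union> B \<subseteq> E" using line_subset assms indep_subset_ground by auto
qed

text \<open>
A line and a basis meeting it in two points contain no circuits other than those of the line: by
augmentation, these two points of the basis may be exchanged for any other two points of the line.
This describes the whole matroid when the line is as long as possible (\<open>long_line\<close>), and all but one
point of it when the line is one shorter (\<open>almost_long_line\<close>).
\<close>

lemma indep_in_line_Un_basis:
  assumes B: "B \<in> I" "{x, y} \<subseteq> B" "x \<noteq> y" "card B = rank I"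
    and S: "S \<subseteq> line E I x y \<union> B" "card (S \<inter> line E I x y) \<le> 2"
  shows "S \<in> I"
proof -
  have xy: "x \<in> E" "y \<in> E" using B indep_subset_ground by auto
  let ?L = "line E I x y"
  have "card {x, y} \<le> card ?L"
    by (rule card_mono[OF finite_line ends_in_line[OF xy]])
  then have "2 \<le> card ?L" using B(3) by simp
  then obtain Q where Q: "S \<inter> ?L \<subseteq> Q" "Q \<subseteq> ?L" "card Q = 2"
    using exists_subset_between[of "S \<inter> ?L" 2 ?L] S(2) finite_line by auto
  have QI: "Q \<in> I" using Q line_subset[of x y] by (intro small_indep) auto
  have finQ: "finite Q" using QI finite_indep by blast
  have finB: "finite B" using B finite_indep by blast
  obtain C where C: "C \<subseteq> B - Q" "Q \<union> C \<in> I" "card (Q \<union> C) = card B"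
    using augment[OF QI B(1)] B(4) card_indep_le_rank[OF QI] by auto
  have "z \<notin> C" if "z \<in> {x, y}" for z
  proof
    assume z: "z \<in> C"
    have "insert z Q \<subseteq> ?L" "card (insert z Q) = 3"
      using Q z C that finQ ends_in_line[OF xy] by auto
    then have "insert z Q \<notin> I" using line_triple_dep xy B(3) by blast
    moreover have "insert z Q \<subseteq> Q \<union> C" using z by blast
    ultimately show False using C(2) indep_subset by blast
  qed
  then have sub: "C \<subseteq> B - {x, y}" using C by blast
  have "card (Q \<union> C) = 2 + card C"
    using C(1) finQ finB Q(3) finite_subset[of C B] by (subst card_Un_disjoint) auto
  moreover have "card (B - {x, y}) = card B - 2"
    using B finB by (simp add: card_Diff_subset)
  ultimately have "C = B - {x, y}"
    using sub C(3) finB by (intro card_subset_eq) auto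
  moreover have "S \<subseteq> Q \<union> (B - {x, y})"
    using S(1) Q(1) line_Int_indep[OF B(1,2)] by blast
  ultimately show ?thesis using C(2) indep_subset by blast
qed

text \<open>
By counting, the line and a basis extending two of its points exhaust the ground set.
\<close>

lemma long_line:
  assumes xy: "x \<in> E" "y \<in> E" "x \<noteq> y"
    and k: "card E = rank I + k" "k + 2 \<le> card (line E I x y)"
  shows "card (line E I x y) = k + 2"
    and "T \<subseteq> E \<Longrightarrow> card T = 3 \<Longrightarrow> T \<notin> I \<longleftrightarrow> T \<subseteq> line E I x y"
proof -
  let ?L = "line E I x y"
  obtain B where B: "{x, y} \<subseteq> B" "B \<in> I" "card B = rank I"
    using extend_to_basis[OF pair_indep[OF xy(1,2)]] by blast
  note LB = card_line_Un_basis[OF B(2,1) xy(3) B(3)]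
  have "card (?L \<union> B) \<le> card E" using LB(2) finite_ground card_mono by blast
  then show L: "card ?L = k + 2" using LB(1) k by linarith
  have "?L \<union> B = E"
    using LB k L finite_ground by (intro card_subset_eq) auto
  moreover have "card (T \<inter> ?L) \<le> 2" if "card T = 3" "\<not> T \<subseteq> ?L"
  proof -
    have "finite T" using that(1) by (simp add: card_ge_0_finite)
    then have "card (T \<inter> ?L) < card T" using that(2) by (intro psubset_card_mono) auto
    then show ?thesis using that(1) by simp
  qed
  ultimately show "T \<notin> I \<longleftrightarrow> T \<subseteq> ?L" if "T \<subseteq> E" "card T = 3"
    using that indep_in_line_Un_basis[OF B(2,1) xy(3) B(3), of T] line_triple_dep[OF xy] by blast
qed

lemma card_dep_triples_pair:
  assumes "x \<in> E" "y \<in> E" "x \<noteq> y"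
  shows "card (dep_triples E I {x, y}) \<le> card (line E I x y) - 2"
proof -
  have "dep_triples E I {x, y} \<subseteq> (\<lambda>z. {x, y, z}) ` (line E I x y - {x, y})"
  proof
    fix T assume "T \<in> dep_triples E I {x, y}"
    then have T: "{x, y} \<subseteq> T" "T \<subseteq> E" "card T = 3" "T \<notin> I" by (auto simp: dep_triples_def)
    have "finite T" using T by (simp add: card_ge_0_finite)
    then have "card (T - {x, y}) = 1" using T assms by (subst card_Diff_subset) auto
    then obtain z where z: "T - {x, y} = {z}" using card_1_singletonE by blast
    then have "T = {x, y, z}" using T(1) by blast
    then show "T \<in> (\<lambda>z. {x, y, z}) ` (line E I x y - {x, y})"
      using T z by (auto simp: line_def)
  qed
  then have "card (dep_triples E I {x, y}) \<le> card (line E I x y - {x, y})"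
    using finite_line by (meson card_image_le card_mono finite_Diff finite_imageI le_trans)
  also have "\<dots> = card (line E I x y) - 2"
    using assms ends_in_line[of x y] by (subst card_Diff_subset) auto
  finally show ?thesis .
qed

text \<open>
Such a line together with a basis extending two of its points leaves out a single point \<open>e\<close>. Every
dependent triple not contained in the line contains \<open>e\<close>. If there were two, then eliminating \<open>e\<close> would make the union
of their other points dependent, but it has at most two points on the line.
\<close>

lemma almost_long_line:
  assumes xy: "x \<in> E" "y \<in> E" "x \<noteq> y"
    and k: "card E = rank I + k" "card (line E I x y) = k + 1"
  shows "card (dep_triples E I {}) \<le> (k + 1 choose 3) + 1"
proof -
  let ?L = "line E I x y"
  define N where "N = {T. T \<subseteq> E \<and> card T = 3 \<and> T \<notin> I \<and> \<not> T \<subseteq> ?L}"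
  obtain B where B: "{x, y} \<subseteq> B" "B \<in> I" "card B = rank I"
    using extend_to_basis[OF pair_indep[OF xy(1,2)]] by blast
  note LB = card_line_Un_basis[OF B(2,1) xy(3) B(3)]
  note indep = indep_in_line_Un_basis[OF B(2,1) xy(3) B(3)]
  have "card (E - (?L \<union> B)) = card E - card (?L \<union> B)"
    using LB(2) finite_ground finite_subset by (intro card_Diff_subset) auto
  then have "card (E - (?L \<union> B)) = 1" using LB(1) k by linarith
  then obtain e where e: "E - (?L \<union> B) = {e}" using card_1_singletonE by blast
  have shape: "\<exists>a b. T = {e, a, b} \<and> a \<noteq> b \<and> a \<noteq> e \<and> b \<noteq> e \<and> b \<notin> ?L \<and> a \<in> E \<and> b \<in> E"
    if "T \<in> N" for T
  proof -
    have T: "T \<subseteq> E" "card T = 3" "T \<notin> I" "\<not> T \<subseteq> ?L" using that by (auto simp: N_def)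
    have fin: "finite T" using T(2) by (simp add: card_ge_0_finite)
    have "card (T \<inter> ?L) < card T" using fin T(4) by (intro psubset_card_mono) auto
    then have "\<not> T \<subseteq> ?L \<union> B" using indep[of T] T by auto
    then obtain v where "v \<in> T" "v \<in> E - (?L \<union> B)" using T(1) by blast
    then have "e \<in> T" using e by simp
    then have "card (T - {e}) = 2" using fin T(2) by simp
    then obtain a b where ab: "T - {e} = {a, b}" "a \<noteq> b" by (auto simp: card_2_iff)
    have Tab: "T = {e, a, b}" using ab \<open>e \<in> T\<close> by blast
    have "\<not> (a \<in> ?L \<and> b \<in> ?L)"
      using line_closed[OF xy, of a b e] ab Tab T e by (auto simp: insert_commute)
    then show ?thesis
      using ab T(1) Tab by (metis Diff_iff insertI1 insert_commute insert_iff subsetD)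
  qed
  have unique: "T = T'" if "T \<in> N" "T' \<in> N" for T T'
  proof (rule ccontr)
    assume "T \<noteq> T'"
    from shape[OF that(1)] obtain a b where
      ab: "T = {e, a, b}" "a \<noteq> b" "a \<noteq> e" "b \<noteq> e" "b \<notin> ?L" "a \<in> E" "b \<in> E" by blast
    from shape[OF that(2)] obtain c f where
      cf: "T' = {e, c, f}" "c \<noteq> f" "c \<noteq> e" "f \<noteq> e" "f \<notin> ?L" "c \<in> E" "f \<in> E" by blast
    have dep: "T \<notin> I" "T' \<notin> I" and eE: "e \<in> E" using that e by (auto simp: N_def)
    define U where "U = {a, b, c, f}"
    have "U \<inter> ?L \<subseteq> {a, c}" using ab cf by (auto simp: U_def)
    then have "card (U \<inter> ?L) \<le> card {a, c}" by (intro card_mono) auto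
    also have "\<dots> \<le> 2" by (simp add: card_insert_if)
    finally have "card (U \<inter> ?L) \<le> 2" .
    moreover have "U \<subseteq> ?L \<union> B" using e ab cf unfolding U_def by auto
    ultimately have UI: "U \<in> I" using indep by blast
    show False
    \<comment> \<open>The two triples share only \<open>e\<close>, or \<open>e\<close> and one more point \<open>p\<close>.\<close>
    proof (cases "{a, b} \<inter> {c, f} = {}")
      case True
      have "{e, a} \<in> I" using eE ab by (intro pair_indep) auto
      moreover have cU: "card U = 4" using True ab cf by (auto simp: U_def)
      moreover have "card {e, a} \<le> card U" using cU ab by simp
      ultimately obtain C where
        C: "C \<subseteq> U - {e, a}" "{e, a} \<union> C \<in> I" "card ({e, a} \<union> C) = 4"
        using augment[of "{e, a}" U] UI by metis
      have "b \<notin> C"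
        using indep_subset[OF C(2), of T] dep ab by auto
      then have sub: "C \<subseteq> {c, f}" using C(1) by (auto simp: U_def)
      have "\<not> C \<subset> {c, f}"
      proof
        assume "C \<subset> {c, f}"
        then have "card C < card {c, f}" by (intro psubset_card_mono) auto
        moreover have "card ({e, a} \<union> C) \<le> card {e, a} + card C" by (rule card_Un_le)
        ultimately show False using C(3) cf ab by simp
      qed
      then have "C = {c, f}" using sub by blast
      then show False using indep_subset[OF C(2), of T'] dep cf by auto
    next
      case False
      then obtain p where p: "p \<in> {a, b}" "p \<in> {c, f}" by blast
      obtain q where q: "T = {e, p, q}" "q \<noteq> e" "q \<noteq> p" "q \<in> U"
        using p ab by (auto simp: U_def insert_commute)
      obtain r where r: "T' = {e, p, r}" "r \<noteq> e" "r \<noteq> p" "r \<in> U"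
        using p cf by (auto simp: U_def insert_commute)
      have "q \<noteq> r" using q r \<open>T \<noteq> T'\<close> by auto
      have W: "{p, q, r} \<in> I" using UI p q r by (intro indep_subset[OF UI]) (auto simp: U_def)
      have "p \<in> E" "p \<noteq> e" using p ab by auto
      then have "{e, p} \<in> I" using eE by (intro pair_indep)
      moreover have "card {e, p} < card {p, q, r}"
        using \<open>p \<noteq> e\<close> \<open>q \<noteq> r\<close> q r by simp
      ultimately obtain z where "z \<in> {p, q, r} - {e, p}" "insert z {e, p} \<in> I"
        using indep_exchange[of "{e, p}" "{p, q, r}"] W by blast
      then show False using dep q r by (auto simp: insert_commute)
    qed
  qed
  have finN: "finite N"
    by (rule finite_subset[of _ "Pow E"]) (auto simp: N_def finite_ground)
  have "dep_triples E I {} \<subseteq> {T. T \<subseteq> ?L \<and> card T = 3} \<union> N"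
    by (auto simp: dep_triples_def N_def)
  moreover have "finite {T. T \<subseteq> ?L \<and> card T = 3}"
    using finite_line by simp
  ultimately have "card (dep_triples E I {}) \<le> card {T. T \<subseteq> ?L \<and> card T = 3} + card N"
    using finN by (meson card_Un_le card_mono finite_UnI le_trans)
  moreover have "card N \<le> 1" using unique finN by (simp add: card_le_Suc0_iff_eq)
  moreover have "card {T. T \<subseteq> ?L \<and> card T = 3} = (k + 1 choose 3)"
    using n_subsets[OF finite_line] k by simp
  ultimately show ?thesis by linarith
qed

end

section \<open>Counting dependent triples\<close>

lemma two_times_choose_two: "2 * (Suc n choose 2) = n * Suc n"
  by (induction n) (simp_all add: numeral_2_eq_2 algebra_simps)

lemma choose_two_superadditive: "(a + 1 choose 2) + (b + 1 choose 2) \<le> (a + b + 1 choose 2)"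
  using two_times_choose_two[of a] two_times_choose_two[of b] two_times_choose_two[of "a + b"]
  by (simp add: algebra_simps)

lemma sum_choose_two_le:
  assumes "finite J"
  shows "(\<Sum>t\<in>J. u t + 1 choose 2) \<le> (\<Sum>t\<in>J. u t) + 1 choose 2"
  using assms
proof (induction J)
  case (insert t J)
  then show ?case using choose_two_superadditive[of "u t" "sum u J"] by simp
qed simp

text \<open>
Convexity of \<open>a choose 2\<close>: among the splittings of \<open>k\<close> into two positive parts the most uneven one, \<open>(k - 1) + 1\<close>,
has the largest sum, and the product term is the exact loss of the splitting \<open>a + (k - a)\<close>.
\<close>

lemma choose_two_split:
  assumes "a + b \<le> k" "1 \<le> a" "a + 1 \<le> k"
  shows "(a + 1 choose 2) + (b + 1 choose 2) + (a - 1) * (k - a - 1) \<le> (k choose 2) + 1"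
proof -
  obtain a' where a': "a = Suc a'" using assms by (cases a) auto
  obtain c where c: "k = a + 1 + c" using assms le_Suc_ex by blast
  have "(b + 1 choose 2) \<le> (c + 1 + 1 choose 2)"
    using assms c by (intro binomial_right_mono) auto
  moreover have "2 * (a + 1 choose 2) = a * Suc a" "2 * (c + 1 + 1 choose 2) = (c + 1) * Suc (c + 1)"
    "2 * (k choose 2) = (a + c) * Suc (a + c)"
    using two_times_choose_two[of a] two_times_choose_two[of "c+1"] two_times_choose_two[of "a + c"] c by simp_all
  ultimately show ?thesis using a' c by (simp add: algebra_simps)
qed

text \<open>
The two bounds that control the dependent triples through a point, where \<open>u t + 2\<close> will be the number
of points of a line \<open>t\<close> through it. One part is split off and the others are merged into a second part.
The unit by which the first bound exceeds \<open>k choose 2\<close> is attained by the parts \<open>k - 1\<close> and 1, so it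
disappears when all parts are at most \<open>k - 2\<close> and \<open>k \<ge> 3\<close>.
\<close>

lemma sum_choose_two_bounded:
  assumes fin: "finite J" and sum: "(\<Sum>t\<in>J. u t) \<le> k" and u: "\<And>t. t \<in> J \<Longrightarrow> u t + 1 \<le> k"
  shows "(\<Sum>t\<in>J. u t + 1 choose 2) \<le> (k choose 2) + (if k \<ge> 2 then 1 else 0)"
    and "k \<ge> 3 \<Longrightarrow> (\<And>t. t \<in> J \<Longrightarrow> u t + 2 \<le> k) \<Longrightarrow> (\<Sum>t\<in>J. u t + 1 choose 2) \<le> k choose 2"
proof -
  have split: "(\<Sum>t\<in>J. u t + 1 choose 2) + (u s - 1) * (k - u s - 1) \<le> (k choose 2) + 1"
    if s: "s \<in> J" "1 \<le> u s" for s
  proof -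
    have "sum u J = u s + sum u (J - {s})" using fin s by (simp add: sum.remove)
    then have "(u s + 1 choose 2) + (sum u (J - {s}) + 1 choose 2) + (u s - 1) * (k - u s - 1)
        \<le> (k choose 2) + 1"
      using sum u[OF s(1)] s(2) by (intro choose_two_split) auto
    moreover have "(\<Sum>t\<in>J. u t + 1 choose 2)
        \<le> (u s + 1 choose 2) + (sum u (J - {s}) + 1 choose 2)"
      using sum_choose_two_le[of "J - {s}" u] fin s by (simp add: sum.remove)
    ultimately show ?thesis by linarith
  qed
  have zero: "(\<Sum>t\<in>J. u t + 1 choose 2) = 0" if "\<forall>t\<in>J. u t = 0"
    using that by (simp add: binomial_eq_0)
  show "(\<Sum>t\<in>J. u t + 1 choose 2) \<le> (k choose 2) + (if k \<ge> 2 then 1 else 0)"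
  proof (cases "\<forall>t\<in>J. u t = 0")
    case False
    then obtain s where s: "s \<in> J" "1 \<le> u s" by fastforce
    then show ?thesis using split[OF s] u[OF s(1)] by simp
  qed (use zero in linarith)
  show "(\<Sum>t\<in>J. u t + 1 choose 2) \<le> k choose 2" if k: "k \<ge> 3" and u2: "\<And>t. t \<in> J \<Longrightarrow> u t + 2 \<le> k"
  \<comment> \<open>A part between 2 and \<open>k - 2\<close> makes the product term positive; otherwise all parts are at most 1, and \<open>k \<le> k choose 2\<close>.\<close>
  proof (cases "\<exists>s\<in>J. 2 \<le> u s")
    case True
    then obtain s where s: "s \<in> J" "2 \<le> u s" by blast
    then have "0 < u s - 1" "0 < k - u s - 1" using u2[OF s(1)] by linarith+
    then have "1 \<le> (u s - 1) * (k - u s - 1)" by (metis Suc_leI One_nat_def nat_0_less_mult_iff)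
    then show ?thesis using split[of s] s by linarith
  next
    case False
    have "(\<Sum>t\<in>J. u t + 1 choose 2) = sum u J"
    proof (rule sum.cong)
      fix t assume "t \<in> J"
      then have "u t = 0 \<or> u t = 1" using False by fastforce
      then show "(u t + 1 choose 2) = u t" by (auto simp: numeral_2_eq_2)
    qed simp
    moreover have "k \<le> k choose 2"
    proof -
      obtain j where "k = Suc j" "2 \<le> j" using k by (cases k) auto
      then have "2 * Suc j \<le> j * Suc j" by (intro mult_le_mono1)
      then have "2 * k \<le> j * Suc j" using \<open>k = Suc j\<close> by simp
      then have "2 * k \<le> 2 * (k choose 2)" using two_times_choose_two[of j] \<open>k = Suc j\<close> by simp
      then show ?thesis by simp
    qed
    ultimately show ?thesis using sum by linarith
  qed
qed

context simple_matroid
begin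

text \<open>
The lines through \<open>x\<close> partition the other points, and there are at least \<open>rank I - 1\<close> of them, as those
through the other points of a basis containing \<open>x\<close> are distinct. So the numbers \<open>u L\<close> of points of \<open>L\<close> in
excess of 2 add up to at most \<open>k\<close>. A dependent triple through \<open>x\<close> is a pair of further points on one
of these lines.
\<close>

lemma dep_triples_point:
  assumes x: "x \<in> E" and k: "card E = rank I + k"
    and lines: "\<And>y. y \<in> E \<Longrightarrow> y \<noteq> x \<Longrightarrow> card (line E I x y) \<le> m + 1"
    and m: "m \<le> k"
  shows "card (dep_triples E I {x}) \<le> (k choose 2) + (if k \<ge> 2 then 1 else 0)"
    and "k \<ge> 3 \<Longrightarrow> m + 1 \<le> k \<Longrightarrow> card (dep_triples E I {x}) \<le> k choose 2"
proof -
  define \<L> where "\<L> = line E I x ` (E - {x})"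
  define u where "u L = card L - 2" for L :: "'a set"
  have fin: "finite \<L>" using finite_ground by (simp add: \<L>_def)
  have LD: "x \<in> L" "finite L" "2 \<le> card L" "card L \<le> m + 1" if L: "L \<in> \<L>" for L
  proof -
    obtain y where y: "y \<in> E" "y \<noteq> x" "L = line E I x y" using L unfolding \<L>_def by blast
    show "finite L" using y finite_line by simp
    have xy: "{x, y} \<subseteq> L" using ends_in_line[OF x y(1)] y by simp
    then show "x \<in> L" by simp
    have "card {x, y} \<le> card L" using xy \<open>finite L\<close> by (intro card_mono)
    then show "2 \<le> card L" using y by simp
    show "card L \<le> m + 1" using lines y by simp
  qed
  have L_eq: "L = line E I x y" if L: "L \<in> \<L>" and y: "y \<in> L" "y \<noteq> x" for L y
  proof -
    obtain z where z: "z \<in> E" "z \<noteq> x" "L = line E I x z" using L unfolding \<L>_def by blast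
    then show ?thesis using line_unique[of x z x y] x y LD(1)[OF L] by auto
  qed
  have "E - {x} = (\<Union>L\<in>\<L>. L - {x})"
  proof
    show "E - {x} \<subseteq> (\<Union>L\<in>\<L>. L - {x})"
      using ends_in_line[OF x] by (fastforce simp: \<L>_def)
    show "(\<Union>L\<in>\<L>. L - {x}) \<subseteq> E - {x}" using line_subset by (auto simp: \<L>_def)
  qed
  moreover have "card (\<Union>L\<in>\<L>. L - {x}) = (\<Sum>L\<in>\<L>. card (L - {x}))"
  proof (rule card_UN_disjoint[OF fin])
    show "\<forall>L\<in>\<L>. finite (L - {x})" using LD(2) by simp
    have "L = M" if "L \<in> \<L>" "M \<in> \<L>" "y \<in> L - {x}" "y \<in> M - {x}" for L M y
      using L_eq[of L y] L_eq[of M y] that by simp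
    then show "\<forall>L\<in>\<L>. \<forall>M\<in>\<L>. L \<noteq> M \<longrightarrow> (L - {x}) \<inter> (M - {x}) = {}" by blast
  qed
  ultimately have "card (E - {x}) = (\<Sum>L\<in>\<L>. card (L - {x}))" by simp
  also have "\<dots> = (\<Sum>L\<in>\<L>. u L + 1)"
  proof (rule sum.cong)
    fix L assume "L \<in> \<L>"
    then show "card (L - {x}) = u L + 1" using LD[of L] by (simp add: u_def)
  qed simp
  also have "\<dots> = sum u \<L> + card \<L>" by (subst sum.distrib) simp
  finally have sum1: "card E = sum u \<L> + card \<L> + 1"
    using card.remove[OF finite_ground x] by simp
  obtain B where B: "{x, x} \<subseteq> B" "B \<in> I" "card B = rank I"
    using extend_to_basis[OF pair_indep[OF x x]] by blast
  have "inj_on (line E I x) (B - {x})"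
  proof (rule inj_onI)
    fix y z assume yz: "y \<in> B - {x}" "z \<in> B - {x}" "line E I x y = line E I x z"
    have zE: "z \<in> E" using yz B indep_subset_ground by blast
    then have "z \<in> line E I x y" using ends_in_line[OF x zE] yz by simp
    moreover have "{x, y, z} \<in> I" using yz B by (intro indep_subset[OF B(2)]) auto
    ultimately show "y = z" using yz by (auto simp: line_def)
  qed
  then have "card (B - {x}) = card (line E I x ` (B - {x}))" by (simp add: card_image)
  also have "\<dots> \<le> card \<L>"
    using fin B indep_subset_ground[OF B(2)] by (intro card_mono) (auto simp: \<L>_def)
  finally have "rank I \<le> card \<L> + 1"
    using B finite_indep[OF B(2)] by (simp add: card_Diff_singleton)
  then have sum_u: "sum u \<L> \<le> k" using sum1 k by linarith
  have "dep_triples E I {x} \<subseteq> (\<Union>L\<in>\<L>. insert x ` {S. S \<subseteq> L - {x} \<and> card S = 2})"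
  proof
    fix T assume "T \<in> dep_triples E I {x}"
    then have T: "x \<in> T" "T \<subseteq> E" "card T = 3" "T \<notin> I" by (auto simp: dep_triples_def)
    have "finite T" using T by (simp add: card_ge_0_finite)
    then have c2: "card (T - {x}) = 2" using T by simp
    then obtain y z where yz: "T - {x} = {y, z}" "y \<noteq> z" by (auto simp: card_2_iff)
    have Txyz: "T = {x, y, z}" using yz T(1) by blast
    have yzE: "y \<in> E - {x}" "z \<in> E" using yz T by auto
    then have "{y, z} \<subseteq> line E I x y"
      using Txyz T by (auto simp: line_def)
    then have "T - {x} \<subseteq> line E I x y - {x}" using yz by blast
    then have "T \<in> insert x ` {S. S \<subseteq> line E I x y - {x} \<and> card S = 2}"
      using c2 T(1) by (intro image_eqI[of _ _ "T - {x}"]) auto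
    then show "T \<in> (\<Union>L\<in>\<L>. insert x ` {S. S \<subseteq> L - {x} \<and> card S = 2})"
      using yzE(1) by (auto simp: \<L>_def)
  qed
  moreover have finS: "finite {S. S \<subseteq> L - {x} \<and> card S = 2}" if "L \<in> \<L>" for L
    using LD(2)[OF that] by simp
  ultimately have "card (dep_triples E I {x})
      \<le> card (\<Union>L\<in>\<L>. insert x ` {S. S \<subseteq> L - {x} \<and> card S = 2})"
    using fin by (intro card_mono finite_UN_I finite_imageI)
  also have "\<dots> \<le> (\<Sum>L\<in>\<L>. card (insert x ` {S. S \<subseteq> L - {x} \<and> card S = 2}))"
    by (rule card_UN_le[OF fin])
  also have "\<dots> \<le> (\<Sum>L\<in>\<L>. u L + 1 choose 2)"
  proof (rule sum_mono)
    fix L assume L: "L \<in> \<L>"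
    have "card (insert x ` {S. S \<subseteq> L - {x} \<and> card S = 2}) \<le> card {S. S \<subseteq> L - {x} \<and> card S = 2}"
      using finS[OF L] by (rule card_image_le)
    also have "\<dots> = card (L - {x}) choose 2"
      using LD(2)[OF L] by (intro n_subsets) simp
    also have "card (L - {x}) = u L + 1" using LD[OF L] by (simp add: u_def)
    finally show "card (insert x ` {S. S \<subseteq> L - {x} \<and> card S = 2}) \<le> u L + 1 choose 2" .
  qed
  finally have le: "card (dep_triples E I {x}) \<le> (\<Sum>L\<in>\<L>. u L + 1 choose 2)" .
  have uL: "u L + 1 \<le> m" if "L \<in> \<L>" for L using LD(3,4)[OF that] by (simp add: u_def)
  then have uk: "u L + 1 \<le> k" if "L \<in> \<L>" for L using that m le_trans by blast
  show "card (dep_triples E I {x}) \<le> (k choose 2) + (if k \<ge> 2 then 1 else 0)"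
    using sum_choose_two_bounded(1)[OF fin sum_u uk] le by linarith
  show "card (dep_triples E I {x}) \<le> k choose 2" if "k \<ge> 3" "m + 1 \<le> k"
  proof -
    have "u L + 2 \<le> k" if "L \<in> \<L>" for L using uL[OF that] \<open>m + 1 \<le> k\<close> by linarith
    from sum_choose_two_bounded(2)[OF fin sum_u uk \<open>k \<ge> 3\<close> this] show ?thesis using le by linarith
  qed
qed

lemma dep_triples_eq_empty:
  assumes "\<And>x y. x \<in> E \<Longrightarrow> y \<in> E \<Longrightarrow> x \<noteq> y \<Longrightarrow> card (line E I x y) \<le> 2"
  shows "dep_triples E I S = {}"
proof (rule ccontr)
  assume "dep_triples E I S \<noteq> {}"
  then obtain T where T: "T \<subseteq> E" "card T = 3" "T \<notin> I" by (auto simp: dep_triples_def)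
  then obtain x y z where xyz: "T = {x, y, z}" "x \<noteq> y" "x \<noteq> z" "y \<noteq> z"
    by (auto simp: card_3_iff)
  have "T \<subseteq> line E I x y" using T xyz by (auto simp: line_def)
  then have "card T \<le> card (line E I x y)" using finite_line card_mono by blast
  then show False using assms[of x y] T xyz by auto
qed

lemma simple_restrict:
  assumes "P \<subseteq> E"
  shows "simple_matroid P {A \<in> I. A \<subseteq> P}"
proof -
  interpret R: matroid P "{A \<in> I. A \<subseteq> P}" using matroid_restrict[OF assms] .
  show ?thesis using assms pair_indep by unfold_locales auto
qed

end

lemma line_restrict:
  assumes "P \<subseteq> E" "x \<in> P" "y \<in> P"
  shows "line P {A \<in> I. A \<subseteq> P} x y = line E I x y \<inter> P"
  using assms by (auto simp: line_def)

text \<open>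
Induction on \<open>k\<close>, by deleting a point outside a basis. If no line has \<open>k + 1\<close> points then, for \<open>k \<ge> 3\<close>, the
deleted point lies on at most \<open>k choose 2\<close> dependent triples, without the extra 1, so that only the
extra 1 of the induction hypothesis remains; for \<open>k \<le> 2\<close> there are then no dependent triples at all. A line of \<open>k + 1\<close> points is the case of \<open>almost_long_line\<close>, with no
need of induction.
\<close>

lemma card_dep_triples_le:
  assumes "simple_matroid E I" "card E = rank I + k"
    and "\<And>x y. x \<in> E \<Longrightarrow> y \<in> E \<Longrightarrow> x \<noteq> y \<Longrightarrow> card (line E I x y) \<le> k + 1"
  shows "card (dep_triples E I {}) \<le> (k + 1 choose 3) + (if k \<ge> 2 then 1 else 0)"
  using assms
proof (induction k arbitrary: E I)
  case 0
  then interpret simple_matroid E I by simp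
  obtain B where B: "B \<in> I" "card B = rank I"
    using extend_to_basis[OF indep_empty] by blast
  have "B = E"
    using B 0 finite_ground indep_subset_ground by (intro card_subset_eq) auto
  then have "dep_triples E I {} = {}"
    using B indep_subset by (auto simp: dep_triples_def)
  then show ?case by simp
next
  case (Suc k)
  then interpret simple_matroid E I by simp
  consider "k = 0" | x y where "k \<ge> 1" "x \<in> E" "y \<in> E" "x \<noteq> y" "card (line E I x y) = Suc k + 1"
    | "k = 1" "\<And>x y. x \<in> E \<Longrightarrow> y \<in> E \<Longrightarrow> x \<noteq> y \<Longrightarrow> card (line E I x y) \<le> k + 1"
    | "k \<ge> 2" "\<And>x y. x \<in> E \<Longrightarrow> y \<in> E \<Longrightarrow> x \<noteq> y \<Longrightarrow> card (line E I x y) \<le> k + 1"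
  proof -
    have "\<forall>x\<in>E. \<forall>y\<in>E. x \<noteq> y \<longrightarrow> card (line E I x y) \<le> k + 1"
      if "\<nexists>x y. x \<in> E \<and> y \<in> E \<and> x \<noteq> y \<and> card (line E I x y) = Suc k + 1"
      using that Suc.prems(3) by (simp add: le_Suc_eq) blast
    moreover consider "k = 0" | "k = 1" | "k \<ge> 2" by linarith
    ultimately show thesis using that by (metis le_refl one_le_numeral le_trans)
  qed
  then show ?case
  proof cases
    case 1
    then have "card (line E I x y) \<le> 2" if "x \<in> E" "y \<in> E" "x \<noteq> y" for x y
      using Suc.prems(3)[OF that] by simp
    then have "dep_triples E I {} = {}" by (rule dep_triples_eq_empty)
    then show ?thesis by simp
  next
    case 2
    then show ?thesis using almost_long_line[OF 2(2-4) Suc.prems(2) 2(5)] by simp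
  next
    case 3
    then have "card (line E I x y) \<le> 2" if "x \<in> E" "y \<in> E" "x \<noteq> y" for x y
      using 3(2)[OF that] by simp
    then have "dep_triples E I {} = {}" by (rule dep_triples_eq_empty)
    then show ?thesis by simp
  next
    case 4
    obtain B where B: "B \<in> I" "card B = rank I"
      using extend_to_basis[OF indep_empty] by blast
    have "card B < card E" using B Suc.prems by simp
    then have "\<not> E \<subseteq> B" using card_mono[OF finite_indep[OF B(1)], of E] by linarith
    then obtain e where e: "e \<in> E" "e \<notin> B" by blast
    let ?P = "E - {e}"
    let ?J = "{A \<in> I. A \<subseteq> ?P}"
    have "B \<subseteq> ?P" using B e indep_subset_ground by auto
    then have rk: "rank ?J = rank I" using rank_restrict[of ?P B] B by auto
    have fin: "finite (dep_triples E I S)" for S using finite_dep_triples[OF finite_ground] .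
    have finJ: "finite (dep_triples ?P ?J S)" for S
      using finite_ground by (intro finite_dep_triples) simp
    have "card (dep_triples ?P ?J {}) \<le> (k + 1 choose 3) + (if k \<ge> 2 then 1 else 0)"
    proof (rule Suc.IH)
      show "simple_matroid ?P ?J" by (rule simple_restrict) auto
      show "card ?P = rank ?J + k" using rk Suc.prems(2) e by simp
      fix x y assume xy: "x \<in> ?P" "y \<in> ?P" "x \<noteq> y"
      then have "card (line ?P ?J x y) \<le> card (line E I x y)"
        by (subst line_restrict) (auto intro: card_mono finite_line)
      then show "card (line ?P ?J x y) \<le> k + 1" using 4(2)[of x y] xy by auto
    qed
    moreover have "card (dep_triples E I {e}) \<le> Suc k choose 2"
    proof (rule dep_triples_point(2)[OF e(1) Suc.prems(2), of k])
      show "card (line E I e y) \<le> k + 1" if "y \<in> E" "y \<noteq> e" for y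
        using 4(2)[of e y] e that by auto
    qed (use 4 in auto)
    moreover have "dep_triples E I {} \<subseteq> dep_triples E I {e} \<union> dep_triples ?P ?J {}"
      by (auto simp: dep_triples_def)
    then have "card (dep_triples E I {}) \<le> card (dep_triples E I {e}) + card (dep_triples ?P ?J {})"
      using fin finJ by (meson card_Un_le card_mono finite_UnI le_trans)
    moreover have "(Suc k + 1 choose 3) = (k + 1 choose 3) + (Suc k choose 2)"
      by (simp add: numeral_3_eq_3 numeral_2_eq_2)
    ultimately show ?thesis using 4 by simp
  qed
qed

lemma (in simple_matroid) card_dep_triples_containing:
  assumes k: "card E = rank I + k"
    and lines: "\<And>x y. x \<in> E \<Longrightarrow> y \<in> E \<Longrightarrow> x \<noteq> y \<Longrightarrow> card (line E I x y) \<le> k + 1"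
    and S: "S \<subseteq> E" "card S \<le> 2"
  shows "card (dep_triples E I S) \<le> (k + 1 - card S choose (3 - card S))
    + (if k \<ge> 2 \<and> card S \<le> 1 then 1 else 0)"
proof -
  have fin: "finite S" using S finite_ground finite_subset by blast
  consider "S = {}" | x where "S = {x}" | x y where "S = {x, y}" "x \<noteq> y"
  proof -
    consider "card S = 0" | "card S = 1" | "card S = 2" using S(2) by linarith
    then show thesis
      using that fin card_1_singletonE[of S thesis] by cases (auto simp: card_2_iff)
  qed
  then show ?thesis
  proof cases
    case 1
    then show ?thesis
      using card_dep_triples_le[OF simple_matroid_axioms k lines] by simp
  next
    case (2 x)
    then show ?thesis
      using dep_triples_point(1)[OF _ k, of x k] S lines by (simp add: numeral_2_eq_2)
  next
    case (3 x y)
    then show ?thesis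
      using card_dep_triples_pair[of x y] lines[of x y] S by (simp add: numeral_2_eq_2)
  qed
qed

section \<open>Parallel classes\<close>

locale loopless_matroid = matroid +
  assumes singleton_indep: "e \<in> E \<Longrightarrow> {e} \<in> I"

definition partite :: "('v \<Rightarrow> 'c) \<Rightarrow> 'v set \<Rightarrow> 'v set set" where
  "partite c Y = {y. y \<subseteq> Y \<and> inj_on c y}"

definition parallel :: "'a set set \<Rightarrow> 'a \<Rightarrow> 'a \<Rightarrow> bool" where
  "parallel I e f \<longleftrightarrow> e = f \<or> {e, f} \<notin> I"

text \<open>
The element is selected by a predicate that depends only on the parallel class of \<open>e\<close>, so that parallel
elements receive the same representative.
\<close>

definition rep :: "'a set \<Rightarrow> 'a set set \<Rightarrow> 'a \<Rightarrow> 'a" where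
  "rep E I e = (SOME f. f \<in> E \<and> parallel I e f)"

definition reps :: "'a set \<Rightarrow> 'a set set \<Rightarrow> 'a set" where
  "reps E I = rep E I ` E"

lemma parallel_sym: "parallel I e f \<Longrightarrow> parallel I f e"
  by (auto simp: parallel_def insert_commute)

context loopless_matroid
begin

lemma parallel_trans:
  assumes "e \<in> E" "f \<in> E" "g \<in> E" "parallel I e f" "parallel I f g"
  shows "parallel I e g"
proof (rule ccontr)
  assume "\<not> parallel I e g"
  then have eg: "e \<noteq> g" "{e, g} \<in> I" by (auto simp: parallel_def)
  then obtain z where "z \<in> {e, g} - {f}" "insert z {f} \<in> I"
    using indep_exchange[of "{f}" "{e, g}"] singleton_indep[OF assms(2)] by auto
  then show False using assms(4,5) eg by (auto simp: parallel_def insert_commute)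
qed

lemma rep_parallel: "e \<in> E \<Longrightarrow> rep E I e \<in> E \<and> parallel I e (rep E I e)"
  unfolding rep_def by (rule someI[of _ e]) (simp add: parallel_def)

lemma rep_eq_iff:
  assumes "e \<in> E" "f \<in> E"
  shows "rep E I e = rep E I f \<longleftrightarrow> parallel I e f"
proof
  assume "rep E I e = rep E I f"
  then have "parallel I (rep E I e) f" using rep_parallel[OF assms(2)] by (simp add: parallel_sym)
  then show "parallel I e f"
    using parallel_trans[of e "rep E I e" f] rep_parallel[OF assms(1)] assms by simp
next
  assume ef: "parallel I e f"
  have "(g \<in> E \<and> parallel I e g) = (g \<in> E \<and> parallel I f g)" for g
    using parallel_trans[OF assms(2,1), of g] parallel_trans[OF assms, of g] ef parallel_sym[OF ef]
    by blast
  then show "rep E I e = rep E I f" by (simp add: rep_def)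
qed

lemma rep_rep: "e \<in> E \<Longrightarrow> rep E I (rep E I e) = rep E I e"
  using rep_parallel[of e] rep_eq_iff[of "rep E I e" e] by (simp add: parallel_sym)

lemma reps_subset: "reps E I \<subseteq> E"
  using rep_parallel by (auto simp: reps_def)

lemma rep_fixed: "p \<in> reps E I \<Longrightarrow> rep E I p = p"
  using rep_rep by (auto simp: reps_def)

lemma replace_parallel:
  assumes "S \<in> I" "e \<in> S" "f \<in> E" "parallel I e f"
  shows "insert f (S - {e}) \<in> I"
proof (cases "e = f")
  case True
  then show ?thesis using assms by (simp add: insert_absorb)
next
  case False
  then have ef: "{e, f} \<notin> I" using assms by (simp add: parallel_def)
  have fin: "finite S" using finite_indep assms by blast
  then have "card S \<ge> 1" using assms by (auto simp: Suc_le_eq card_gt_0_iff)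
  then obtain C where C: "C \<subseteq> S - {f}" "{f} \<union> C \<in> I" "card ({f} \<union> C) = card S"
    using augment[OF singleton_indep[OF assms(3)] assms(1)] by auto
  have "e \<notin> C" using ef indep_subset[OF C(2), of "{e, f}"] by auto
  then have sub: "C \<subseteq> S - {e}" using C by blast
  have "finite C" "f \<notin> C" using C fin finite_subset by auto
  then have "card C = card (S - {e})" using C(3) assms(2) fin by simp
  then have "C = S - {e}" using sub fin by (intro card_subset_eq) auto
  then show ?thesis using C by simp
qed

text \<open>
Independence is not affected by moving elements within their parallel classes; the elements of \<open>S\<close> are
moved one at a time.
\<close>

lemma replace_parallels:
  assumes "S \<in> I" "\<And>s. s \<in> S \<Longrightarrow> g s \<in> E \<and> parallel I s (g s)"
  shows "inj_on g S" "g ` S \<in> I"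
proof -
  have SE: "s \<in> E" if "s \<in> S" for s using assms(1) indep_subset_ground that by blast
  have not_par: "s = t" if "s \<in> S" "t \<in> S" "parallel I s t" for s t
    using that indep_subset[OF assms(1), of "{s, t}"] by (auto simp: parallel_def)
  show "inj_on g S"
  proof (rule inj_onI)
    fix s t assume st: "s \<in> S" "t \<in> S" "g s = g t"
    have "parallel I (g s) t" using assms(2)[OF st(2)] st(3) by (simp add: parallel_sym)
    then have "parallel I s t"
      using parallel_trans[of s "g s" t] assms(2)[OF st(1)] SE st by simp
    then show "s = t" using not_par st by blast
  qed
  have "F \<subseteq> S \<Longrightarrow> g ` F \<union> (S - F) \<in> I" if "finite F" for F
    using that
  proof (induction F)
    case (insert s F)
    have "s \<notin> g ` F"
    proof
      assume "s \<in> g ` F"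
      then obtain t where "t \<in> F" "s = g t" by blast
      then have "t = s" using not_par[of t s] assms(2)[of t] insert.prems by auto
      then show False using \<open>t \<in> F\<close> insert.hyps by simp
    qed
    then have "g ` F - {s} = g ` F" by simp
    then have "g ` insert s F \<union> (S - insert s F) = insert (g s) ((g ` F \<union> (S - F)) - {s})"
      by (simp only: Un_Diff Diff_insert[of S s F] image_insert Un_insert_left)
    moreover have "g s \<in> E" "parallel I s (g s)" using assms(2)[of s] insert.prems by auto
    ultimately show ?case
      using replace_parallel[of "g ` F \<union> (S - F)" s "g s"] insert by auto
  qed (simp add: assms)
  from this[OF finite_indep[OF assms(1)]] show "g ` S \<in> I" by simp
qed

lemma indep_iff_rep:
  assumes "S \<subseteq> E"
  shows "S \<in> I \<longleftrightarrow> inj_on (rep E I) S \<and> rep E I ` S \<in> I"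
proof
  assume "S \<in> I"
  then show "inj_on (rep E I) S \<and> rep E I ` S \<in> I"
    using replace_parallels[of S "rep E I"] rep_parallel assms by auto
next
  assume S: "inj_on (rep E I) S \<and> rep E I ` S \<in> I"
  let ?g = "the_inv_into S (rep E I)"
  have "?g ` rep E I ` S \<in> I"
  proof (rule replace_parallels(2))
    fix s assume "s \<in> rep E I ` S"
    then obtain t where t: "t \<in> S" "s = rep E I t" by blast
    then have "?g s = t" using S by (simp add: the_inv_into_f_f)
    then show "?g s \<in> E \<and> parallel I s (?g s)" using t assms rep_parallel[of t] parallel_sym[of I t "rep E I t"] by auto
  qed (use S in simp)
  moreover have "?g ` rep E I ` S = S"
    using S by (simp add: the_inv_into_onto)
  ultimately show "S \<in> I" by simp
qed

lemma rep_image_fixed: "T \<subseteq> reps E I \<Longrightarrow> rep E I ` T = T"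
  using image_cong[of T T "rep E I" id] rep_fixed by (simp add: subset_iff)

definition simple_indeps :: "'a set set" where
  "simple_indeps = {A \<in> I. A \<subseteq> reps E I}"

lemma simple_matroid_reps: "simple_matroid (reps E I) simple_indeps"
proof -
  interpret R: matroid "reps E I" simple_indeps
    using matroid_restrict[OF reps_subset] by (simp add: simple_indeps_def)
  have "{x, y} \<in> I" if "x \<in> reps E I" "y \<in> reps E I" for x y
  proof (cases "x = y")
    case True
    then show ?thesis using that singleton_indep reps_subset by auto
  next
    case False
    then have "\<not> parallel I x y" 
      using rep_eq_iff[of x y] rep_fixed[OF that(1)] rep_fixed[OF that(2)] reps_subset that by auto
    then show ?thesis by (simp add: parallel_def)
  qed
  then show ?thesis by unfold_locales (auto simp: simple_indeps_def)
qed

lemma basis_in_reps: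
  obtains B where "B \<in> I" "B \<subseteq> reps E I" "card B = rank I"
proof -
  obtain B where B: "B \<in> I" "card B = rank I" using extend_to_basis[OF indep_empty] by blast
  then have "inj_on (rep E I) B" "rep E I ` B \<in> I"
    using indep_iff_rep indep_subset_ground by auto
  moreover have "rep E I ` B \<subseteq> reps E I" using indep_subset_ground[OF B(1)] by (auto simp: reps_def)
  ultimately show ?thesis using B(2) that by (metis card_image)
qed

lemma rank_simple_indeps: "rank simple_indeps = rank I"
proof -
  obtain B where "B \<in> I" "B \<subseteq> reps E I" "card B = rank I" by (rule basis_in_reps)
  then show ?thesis unfolding simple_indeps_def by (rule rank_restrict[OF reps_subset])
qed

abbreviation partial_transversals :: "'a set set" where
  "partial_transversals \<equiv> partite (rep E I) (E - reps E I)"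

lemma finite_partial_transversals: "finite partial_transversals"
  by (rule finite_subset[of _ "Pow E"]) (auto simp: partite_def finite_ground)

lemma rep_image_subset: "y \<in> partial_transversals \<Longrightarrow> rep E I ` y \<subseteq> reps E I"
  by (auto simp: partite_def reps_def)

text \<open>
The independent sets \<open>A\<close> correspond to the pairs consisting of the partial transversal \<open>y = A - reps E I\<close> and the
independent set \<open>S = rep E I ` A\<close> of representatives. The set \<open>A\<close> is recovered as \<open>y \<union> (S - rep E I ` y)\<close>.
\<close>

lemma f_count_eq_sum:
  "f_count I i = (\<Sum>y\<in>partial_transversals. card {S \<in> simple_indeps. card S = i \<and> rep E I ` y \<subseteq> S})"
proof -
  let ?r = "rep E I" and ?P = "reps E I"
  let ?N = "\<lambda>y. {S \<in> simple_indeps. card S = i \<and> ?r ` y \<subseteq> S}"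
  let ?f = "\<lambda>A. (A - ?P, ?r ` A)"
  let ?f' = "\<lambda>(y, S). y \<union> (S - ?r ` y)"
  have "bij_betw ?f {A \<in> I. card A = i} (Sigma partial_transversals ?N)"
  proof (rule bij_betw_byWitness[where f' = ?f'])
    have dest: "A \<subseteq> E" "inj_on ?r A" "?r ` A \<in> I" "?r ` A \<subseteq> ?P" if "A \<in> I" for A
    proof -
      show AE: "A \<subseteq> E" using that by (rule indep_subset_ground)
      show "inj_on ?r A" "?r ` A \<in> I" using indep_iff_rep[OF AE] that by blast+
      show "?r ` A \<subseteq> ?P" using AE by (auto simp: reps_def)
    qed
    show "\<forall>A\<in>{A \<in> I. card A = i}. ?f' (?f A) = A"
    proof
      fix A assume "A \<in> {A \<in> I. card A = i}"
      then have A: "A \<in> I" by simp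
      have "?r ` A - ?r ` (A - ?P) = ?r ` (A \<inter> ?P)"
        using inj_on_image_set_diff[OF dest(2)[OF A], of A "A - ?P"] by (simp add: Diff_Diff_Int)
      also have "\<dots> = A \<inter> ?P" by (rule rep_image_fixed) simp
      finally show "?f' (?f A) = A" by auto
    qed
    have props: "?f' (y, S) \<in> I" "?f' (y, S) - ?P = y" "?r ` ?f' (y, S) = S" "card (?f' (y, S)) = i"
      if y: "y \<in> partial_transversals" and S: "S \<in> ?N y" for y S
    proof -
      have yd: "y \<subseteq> E" "y \<inter> ?P = {}" "inj_on ?r y" using y by (auto simp: partite_def)
      have Sd: "S \<in> I" "S \<subseteq> ?P" "card S = i" "?r ` y \<subseteq> S" using S by (auto simp: simple_indeps_def)
      have fix_S: "?r s = s" if "s \<in> S" for s using rep_fixed Sd(2) that by blast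
      have fix_image: "?r ` T = T" if "T \<subseteq> S" for T
        using rep_image_fixed Sd(2) that by blast
      have "inj_on ?r (S - ?r ` y)" using fix_S by (intro inj_onI) simp
      moreover have "?r ` (S - ?r ` y - y) \<subseteq> S - ?r ` y" using fix_image[of "S - ?r ` y - y"] by blast
      ultimately have inj: "inj_on ?r (?f' (y, S))"
        using yd(3) by (auto simp only: inj_on_Un prod.case)
      show im: "?r ` ?f' (y, S) = S" using Sd(4) fix_image[of "S - ?r ` y"] by (auto simp: image_Un)
      have "?f' (y, S) \<subseteq> E" using yd(1) Sd(2) reps_subset by auto
      then show "?f' (y, S) \<in> I" using inj im Sd(1) indep_iff_rep[of "?f' (y, S)"] by simp
      show "card (?f' (y, S)) = i" using card_image[OF inj] im Sd(3) by simp
      show "?f' (y, S) - ?P = y" using yd Sd by auto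
    qed
    show "\<forall>p\<in>Sigma partial_transversals ?N. ?f (?f' p) = p" using props(2,3) by auto
    show "?f ` {A \<in> I. card A = i} \<subseteq> Sigma partial_transversals ?N"
    proof
      fix q assume "q \<in> ?f ` {A \<in> I. card A = i}"
      then obtain A where A: "A \<in> I" "card A = i" "q = ?f A" by blast
      have "A - ?P \<in> partial_transversals"
        using dest[OF A(1)] by (auto simp: partite_def inj_on_def)
      moreover have "?r ` A \<in> ?N (A - ?P)"
        using dest[OF A(1)] A(2) card_image[of ?r A] by (auto simp: simple_indeps_def)
      ultimately show "q \<in> Sigma partial_transversals ?N" using A(3) by simp
    qed
    show "?f' ` Sigma partial_transversals ?N \<subseteq> {A \<in> I. card A = i}"
      using props(1,4) by auto
  qed
  then have "f_count I i = card (Sigma partial_transversals ?N)"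
    unfolding f_count_def by (rule bij_betw_same_card)
  also have "\<dots> = (\<Sum>y\<in>partial_transversals. card (?N y))"
  proof (rule card_SigmaI)
    show "\<forall>y\<in>partial_transversals. finite (?N y)"
      using finite_ground by (auto simp: simple_indeps_def intro!: finite_subset[of _ "Pow E"] dest: indep_subset_ground)
  qed (rule finite_partial_transversals)
  finally show ?thesis .
qed

end

section \<open>The \<open>h\<close>-vector\<close>

lemma card_supersets:
  assumes "finite P" "R \<subseteq> P"
  shows "card {S. R \<subseteq> S \<and> S \<subseteq> P \<and> card S = i}
    = (if card R \<le> i then (card P - card R) choose (i - card R) else 0)"
proof (cases "card R \<le> i")
  case True
  have finR: "finite R" using assms finite_subset by blast
  have "bij_betw (\<lambda>S. S - R) {S. R \<subseteq> S \<and> S \<subseteq> P \<and> card S = i} {S. S \<subseteq> P - R \<and> card S = i - card R}"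
  proof (rule bij_betw_byWitness[where f' = "\<lambda>S. S \<union> R"])
    show "(\<lambda>S. S - R) ` {S. R \<subseteq> S \<and> S \<subseteq> P \<and> card S = i} \<subseteq> {S. S \<subseteq> P - R \<and> card S = i - card R}"
      using finR by (auto simp: card_Diff_subset)
    show "(\<lambda>S. S \<union> R) ` {S. S \<subseteq> P - R \<and> card S = i - card R} \<subseteq> {S. R \<subseteq> S \<and> S \<subseteq> P \<and> card S = i}"
    proof safe
      fix S assume S: "S \<subseteq> P - R" "card S = i - card R"
      have "finite S" "S \<inter> R = {}" using S assms finite_subset[of S P] by auto
      then show "card (S \<union> R) = i" using S finR True by (simp add: card_Un_disjoint)
    qed (use assms in auto)
  qed auto
  then have "card {S. R \<subseteq> S \<and> S \<subseteq> P \<and> card S = i} = card {S. S \<subseteq> P - R \<and> card S = i - card R}"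
    by (rule bij_betw_same_card)
  also have "\<dots> = card (P - R) choose (i - card R)" using assms by (intro n_subsets) simp
  finally show ?thesis using True assms finR by (simp add: card_Diff_subset)
next
  case False
  have "{S. R \<subseteq> S \<and> S \<subseteq> P \<and> card S = i} = {}"
    using False assms card_mono finite_subset by blast
  then show ?thesis using False by (simp only: card.empty if_False)
qed

lemma (in simple_matroid) card_indep_supersets:
  assumes "R \<subseteq> E" "i \<le> 3"
  shows "int (card {S \<in> I. card S = i \<and> R \<subseteq> S})
    = (if card R \<le> i then int ((card E - card R) choose (i - card R)) else 0)
      - (if i = 3 then int (card (dep_triples E I R)) else 0)"
proof (cases "i = 3")
  case True
  have "{S. R \<subseteq> S \<and> S \<subseteq> E \<and> card S = i} = {S \<in> I. card S = i \<and> R \<subseteq> S} \<union> dep_triples E I R"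
    using True indep_subset_ground by (auto simp: dep_triples_def)
  moreover have "{S \<in> I. card S = i \<and> R \<subseteq> S} \<inter> dep_triples E I R = {}"
    by (auto simp: dep_triples_def)
  moreover have "finite {S \<in> I. card S = i \<and> R \<subseteq> S}"
    using finite_ground by (auto intro!: finite_subset[of _ "Pow E"] dest: indep_subset_ground)
  ultimately have "card {S. R \<subseteq> S \<and> S \<subseteq> E \<and> card S = i}
      = card {S \<in> I. card S = i \<and> R \<subseteq> S} + card (dep_triples E I R)"
    using finite_dep_triples[OF finite_ground] by (metis card_Un_disjoint)
  then have "card {S \<in> I. card S = i \<and> R \<subseteq> S} + card (dep_triples E I R)
      = (if card R \<le> i then (card E - card R) choose (i - card R) else 0)"
    using card_supersets[OF finite_ground assms(1), of i] by simp
  then show ?thesis using True by (auto split: if_splits)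
next
  case False
  then have "{S. R \<subseteq> S \<and> S \<subseteq> E \<and> card S = i} = {S \<in> I. card S = i \<and> R \<subseteq> S}"
    using small_indep indep_subset_ground assms(2) by auto
  then show ?thesis using False card_supersets[OF finite_ground assms(1), of i] by simp
qed

lemma h_vec_eq_sum:
  assumes "j \<le> rank I"
  shows "h_vec I j
    = (\<Sum>i\<le>j. int (f_count I i) * ((-1) ^ (j - i) * int ((rank I - i) choose (j - i))))"
proof -
  have X: "[:0, 1:] ^ i = monom (1::int) i" for i by (simp add: monom_altdef)
  have "h_vec I j = (\<Sum>i\<le>rank I. int (f_count I i) *
      (if j < i then 0 else coeff ([:1, -1:] ^ (rank I - i)) (j - i)))"
    unfolding h_vec_def h_poly_def coeff_sum
    by (intro sum.cong refl)
      (simp add: X of_nat_poly mult.assoc coeff_monom_mult del: of_nat_sum)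
  also have "\<dots> = (\<Sum>i\<le>j. int (f_count I i) *
      (if j < i then 0 else coeff ([:1, -1:] ^ (rank I - i)) (j - i)))"
    using assms by (intro sum.mono_neutral_right) auto
  also have "\<dots> = (\<Sum>i\<le>j. int (f_count I i) * ((-1) ^ (j - i) * int ((rank I - i) choose (j - i))))"
    using assms by (intro sum.cong refl) (simp add: coeff_linear_poly_power)
  finally show ?thesis .
qed

text \<open>
Vandermonde's convolution with upper indices \<open>D + k\<close> and \<open>n - D - 1\<close>: negating the upper index absorbs the
sign and makes it independent of \<open>t\<close>.
\<close>

lemma alternating_Vandermonde:
  assumes "n \<le> D"
  shows "(\<Sum>t\<le>n. int ((D + k) choose t) * ((-1) ^ (n - t) * int ((D - t) choose (n - t))))
    = int ((k + n - 1) choose n)"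
proof -
  have summand: "(-1) ^ (n - t) * real ((D - t) choose (n - t)) = (real n - real D - 1) gchoose (n - t)"
    if "t \<le> n" for t
  proof -
    have "real ((D - t) choose (n - t)) = real (D - t) gchoose (n - t)" by (rule binomial_gbinomial)
    also have "\<dots> = (-1) ^ (n - t) * ((real (n - t) - real (D - t) - 1) gchoose (n - t))"
      by (rule gbinomial_negated_upper)
    also have "real (n - t) - real (D - t) - 1 = real n - real D - 1"
      using that assms by (simp add: of_nat_diff)
    finally show ?thesis by (simp add: power_mult_distrib[symmetric] mult.assoc[symmetric])
  qed
  have "(\<Sum>t\<le>n. real ((D + k) choose t) * ((-1) ^ (n - t) * real ((D - t) choose (n - t))))
      = (\<Sum>t\<in>{0..n}. (real (D + k) gchoose t) * ((real n - real D - 1) gchoose (n - t)))"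
    using summand by (intro sum.cong) (auto simp: binomial_gbinomial)
  also have "\<dots> = (real (D + k) + (real n - real D - 1)) gchoose n"
    by (rule gbinomial_Vandermonde)
  also have "real (D + k) + (real n - real D - 1) = real k + real n - 1" by simp
  also have "(real k + real n - 1) gchoose n = real ((k + n - 1) choose n)"
  proof (cases "n = 0")
    case False
    then have "real k + real n - 1 = real (k + n - 1)" by (simp add: of_nat_diff)
    then show ?thesis by (simp only: binomial_gbinomial)
  qed simp
  finally have "real_of_int (\<Sum>t\<le>n. int ((D + k) choose t) * ((-1) ^ (n - t) * int ((D - t) choose (n - t))))
    = real_of_int (int ((k + n - 1) choose n))" by simp
  then show ?thesis by (simp only: of_int_eq_iff)
qed

lemma alternating_Vandermonde_shifted:
  assumes "j \<le> d"
  shows "(\<Sum>i\<le>j. (if r \<le> i then int ((d + k - r) choose (i - r)) else 0)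
      * ((-1) ^ (j - i) * int ((d - i) choose (j - i))))
    = (if r \<le> j then int ((k + (j - r) - 1) choose (j - r)) else 0)"
proof (cases "r \<le> j")
  case True
  let ?g = "\<lambda>i. (if r \<le> i then int ((d + k - r) choose (i - r)) else 0)
      * ((-1) ^ (j - i) * int ((d - i) choose (j - i)))"
  have "(\<Sum>i\<le>j. ?g i) = (\<Sum>i\<in>{r..j}. ?g i)" by (intro sum.mono_neutral_right) auto
  also have "\<dots> = (\<Sum>t\<le>j - r. ?g (t + r))"
    using True by (intro sum.reindex_bij_witness[of _ "\<lambda>t. t + r" "\<lambda>i. i - r"]) auto
  also have "\<dots> = (\<Sum>t\<le>j - r. int ((d - r + k) choose t)
      * ((-1) ^ (j - r - t) * int ((d - r - t) choose (j - r - t))))"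
    using True assms by (intro sum.cong refl) (simp add: algebra_simps)
  also have "\<dots> = int ((k + (j - r) - 1) choose (j - r))"
    using assms by (intro alternating_Vandermonde) simp
  finally show ?thesis using True by simp
qed (simp add: sum.neutral)

context loopless_matroid
begin

text \<open>
If all subsets of \<open>reps E I\<close> were independent as far as size 3, then the sets counted for a fixed \<open>y\<close> would be all
the sets \<open>S\<close> between \<open>rep E I ` y\<close> and \<open>reps E I\<close>, and Vandermonde's identity would yield the number of
monomials of degree \<open>j - card y\<close> in \<open>k\<close> variables. Subsets of size up to 2 are indeed independent, so the
correction by dependent triples occurs only for \<open>j = 3\<close>, where their coefficient is 1.
\<close>

lemma h_vec_eq_sum_transversals:
  assumes k: "card (reps E I) = rank I + k" and j: "j \<le> 3" "j \<le> rank I"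
  shows "h_vec I j = (\<Sum>y\<in>{y \<in> partial_transversals. card y \<le> j}.
    int ((k + (j - card y) - 1) choose (j - card y))
      - (if j = 3 then int (card (dep_triples (reps E I) simple_indeps (rep E I ` y))) else 0))"
proof -
  interpret S: simple_matroid "reps E I" simple_indeps by (rule simple_matroid_reps)
  let ?D = "\<lambda>y. int (card (dep_triples (reps E I) simple_indeps (rep E I ` y)))"
  let ?c = "\<lambda>i. (-1) ^ (j - i) * int ((rank I - i) choose (j - i))"
  let ?b = "\<lambda>y i. if card y \<le> i then int ((rank I + k - card y) choose (i - card y)) else 0"
  have N: "int (card {S \<in> simple_indeps. card S = i \<and> rep E I ` y \<subseteq> S})
      = ?b y i - (if i = 3 then ?D y else 0)"
    if y: "y \<in> partial_transversals" and i: "i \<le> j" for y i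
  proof -
    have "card (rep E I ` y) = card y" using y by (auto simp: partite_def card_image)
    then show ?thesis
      using S.card_indep_supersets[OF rep_image_subset[OF y], of i] k i j by simp
  qed
  have "h_vec I j = (\<Sum>i\<le>j. \<Sum>y\<in>partial_transversals. (?b y i - (if i = 3 then ?D y else 0)) * ?c i)"
    unfolding h_vec_eq_sum[OF j(2)] f_count_eq_sum
    by (intro sum.cong refl) (simp add: sum_distrib_right N)
  also have "\<dots> = (\<Sum>y\<in>partial_transversals. \<Sum>i\<le>j. (?b y i - (if i = 3 then ?D y else 0)) * ?c i)"
    by (rule sum.swap)
  also have "\<dots> = (\<Sum>y\<in>partial_transversals.
      (if card y \<le> j then int ((k + (j - card y) - 1) choose (j - card y)) - (if j = 3 then ?D y else 0)
       else 0))"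
  proof (rule sum.cong[OF refl])
    fix y assume y: "y \<in> partial_transversals"
    have "(\<Sum>i\<le>j. (if i = 3 then ?D y else 0) * ?c i) = (\<Sum>i\<le>j. if i = 3 then ?D y * ?c 3 else 0)"
      by (intro sum.cong) auto
    also have "\<dots> = (if j = 3 then ?D y else 0)" using j by simp
    finally have "(\<Sum>i\<le>j. (?b y i - (if i = 3 then ?D y else 0)) * ?c i)
        = (if card y \<le> j then int ((k + (j - card y) - 1) choose (j - card y)) else 0)
          - (if j = 3 then ?D y else 0)"
      unfolding left_diff_distrib sum_subtractf
      using alternating_Vandermonde_shifted[OF j(2), of "card y" k] by simp
    moreover have "?D y = 0" if "\<not> card y \<le> 3"
    proof -
      have "card (rep E I ` y) = card y" using y by (auto simp: partite_def card_image)
      then have "dep_triples (reps E I) simple_indeps (rep E I ` y) = {}"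
        using that by (auto simp: dep_triples_def dest!: card_mono[rotated] intro: card_ge_0_finite)
      then show ?thesis by simp
    qed
    ultimately show "(\<Sum>i\<le>j. (?b y i - (if i = 3 then ?D y else 0)) * ?c i)
        = (if card y \<le> j then int ((k + (j - card y) - 1) choose (j - card y)) - (if j = 3 then ?D y else 0)
           else 0)" by auto
  qed
  also have "\<dots> = (\<Sum>y\<in>{y \<in> partial_transversals. card y \<le> j}.
      int ((k + (j - card y) - 1) choose (j - card y)) - (if j = 3 then ?D y else 0))"
    by (rule sum.inter_filter[OF finite_partial_transversals, symmetric])
  finally show ?thesis .
qed

end

section \<open>Order ideals\<close>

text \<open>
An order ideal involves finitely many variables, so they may be renamed to natural numbers injectively.
\<close>

lemma pure_O_sequenceI:
  fixes \<O> :: "'v multiset set"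
  assumes "a \<noteq> []" "order_ideal (length a - 1) \<O>" "pure \<O>"
    and "\<And>i. i < length a \<Longrightarrow> a ! i = int (degree_count \<O> i)"
  shows "pure_O_sequence a"
proof -
  define V where "V = (\<Union>\<mu>\<in>\<O>. set_mset \<mu>)"
  have "finite V" using assms(2) by (simp add: order_ideal_def V_def)
  then obtain f :: "'v \<Rightarrow> nat" where f: "inj_on f V"
    using finite_imp_inj_to_nat_seg by metis
  define g where "g = the_inv_into V f"
  have inv: "image_mset g (image_mset f \<mu>) = \<mu>" if "set_mset \<mu> \<subseteq> V" for \<mu>
    using that f by (induction \<mu>) (simp_all add: g_def the_inv_into_f_f)
  have V: "set_mset \<mu> \<subseteq> V" if "\<mu> \<in> \<O>" for \<mu> using that by (auto simp: V_def)
  have inv': "image_mset g (image_mset f \<mu>) = \<mu>" if "\<mu> \<in> \<O>" for \<mu>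
    using inv V that by blast
  define \<O>' where "\<O>' = image_mset f ` \<O>"
  have inj: "inj_on (image_mset f) \<O>" using inv' by (metis inj_on_inverseI)
  have closed: "\<nu> \<in> \<O>" if "\<mu> \<in> \<O>" "\<nu> \<subseteq># \<mu>" for \<mu> \<nu>
    using assms(2) that by (auto simp: order_ideal_def)
  have oi: "order_ideal (length a - 1) \<O>'"
    unfolding order_ideal_def
  proof (intro conjI ballI allI impI)
    show "\<O>' \<noteq> {}" using assms(2) by (auto simp: order_ideal_def \<O>'_def)
    have "(\<Union>\<mu>\<in>\<O>'. set_mset \<mu>) = f ` V" by (auto simp: \<O>'_def V_def)
    then show "finite (\<Union>\<mu>\<in>\<O>'. set_mset \<mu>)" using \<open>finite V\<close> by simp
    fix \<mu>' assume "\<mu>' \<in> \<O>'"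
    then obtain \<mu> where \<mu>: "\<mu> \<in> \<O>" "\<mu>' = image_mset f \<mu>" by (auto simp: \<O>'_def)
    then show "size \<mu>' \<le> length a - 1" using assms(2) by (simp add: order_ideal_def)
    fix \<nu>' assume "\<nu>' \<subseteq># \<mu>'"
    then obtain \<rho> where "image_mset f \<mu> = \<nu>' + \<rho>" using \<mu> by (metis subset_mset.le_iff_add)
    from image_mset_eq_plusD[OF this] obtain \<nu> where "\<nu> \<subseteq># \<mu>" "\<nu>' = image_mset f \<nu>"
      using mset_subset_eq_add_left by metis
    then show "\<nu>' \<in> \<O>'" using closed \<mu> by (auto simp: \<O>'_def)
  qed
  have max: "maximal_monomial \<O> \<mu>" if "maximal_monomial \<O>' (image_mset f \<mu>)" "\<mu> \<in> \<O>" for \<mu>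
    unfolding maximal_monomial_def
  proof (intro conjI ballI impI)
    fix \<nu> assume \<nu>: "\<nu> \<in> \<O>" "\<mu> \<subseteq># \<nu>"
    then have "image_mset f \<nu> \<in> \<O>'" "image_mset f \<mu> \<subseteq># image_mset f \<nu>"
      by (auto simp: \<O>'_def image_mset_subseteq_mono)
    then have "image_mset f \<nu> = image_mset f \<mu>" using that(1) by (simp add: maximal_monomial_def)
    then show "\<nu> = \<mu>" using inj \<nu> that(2) by (simp add: inj_on_def)
  qed (rule that(2))
  have pr: "pure \<O>'"
    unfolding pure_def
  proof (intro allI impI)
    fix \<mu>' \<nu>' assume m: "maximal_monomial \<O>' \<mu>'" "maximal_monomial \<O>' \<nu>'"
    then obtain \<mu> \<nu> where "\<mu> \<in> \<O>" "\<mu>' = image_mset f \<mu>" "\<nu> \<in> \<O>" "\<nu>' = image_mset f \<nu>"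
      by (auto simp: maximal_monomial_def \<O>'_def)
    then show "size \<mu>' = size \<nu>'" using max m assms(3) by (auto simp: pure_def)
  qed
  have "degree_count \<O>' i = degree_count \<O> i" for i
  proof -
    have "{\<mu> \<in> \<O>'. size \<mu> = i} = image_mset f ` {\<mu> \<in> \<O>. size \<mu> = i}" by (auto simp: \<O>'_def)
    then show ?thesis
      unfolding degree_count_def using inj by (simp add: card_image inj_on_def)
  qed
  then show ?thesis
    unfolding pure_O_sequence_def using assms(1,4) oi pr by auto
qed

text \<open>
A monomial is the product of a partial transversal \<open>y\<close>, which is squarefree, and a monomial \<open>m\<close> in \<open>X\<close>. The
monomials of degree at most 2 are unrestricted, while \<open>Z y\<close> selects the cofactors \<open>m\<close> for which \<open>y m\<close> is
one of the cubics; as all smaller monomials are present, any choice of cubics gives an order ideal.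
\<close>

definition cubic_ideal ::
  "'v set \<Rightarrow> ('v \<Rightarrow> 'c) \<Rightarrow> 'v set \<Rightarrow> ('v set \<Rightarrow> 'v multiset set) \<Rightarrow> 'v multiset set" where
  "cubic_ideal X c Y Z = {mset_set y + m | y m. y \<in> partite c Y \<and> set_mset m \<subseteq> X \<and>
     (card y + size m \<le> 2 \<or> (card y \<le> 3 \<and> m \<in> Z y))}"

lemma subset_mset_setD: "A \<subseteq># mset_set y \<Longrightarrow> finite y \<Longrightarrow> \<exists>z\<subseteq>y. A = mset_set z"
proof (intro exI conjI)
  assume A: "A \<subseteq># mset_set y" "finite y"
  show "set_mset A \<subseteq> y" using A set_mset_mono by fastforce
  show "A = mset_set (set_mset A)"
  proof (rule multiset_eqI)
    fix x
    have "count A x \<le> 1" using A mset_subset_eq_count[OF A(1), of x] by (simp add: count_mset_set' split: if_splits)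
    then show "count A x = count (mset_set (set_mset A)) x"
    proof (cases "x \<in># A")
      case True
      then have "0 < count A x" by simp
      then show ?thesis using True \<open>count A x \<le> 1\<close> by (simp add: count_mset_set' del: count_greater_zero_iff)
    qed (simp add: not_in_iff)
  qed
qed

lemma subset_mset_plusD:
  fixes A B C :: "'v multiset"
  assumes "A \<subseteq># B + C"
  obtains A1 A2 where "A = A1 + A2" "A1 \<subseteq># B" "A2 \<subseteq># C"
proof
  show "A = (A \<inter># B) + (A - B)"
    by (rule multiset_eqI) (simp add: min_def)
  show "A \<inter># B \<subseteq># B" by simp
  show "A - B \<subseteq># C" using assms by (simp add: subset_eq_diff_conv add.commute)
qed

locale cubic_ideal_data =
  fixes X Y :: "'v set" and c :: "'v \<Rightarrow> 'c" and Z :: "'v set \<Rightarrow> 'v multiset set"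
  assumes finite_X: "finite X" and finite_Y: "finite Y" and disjoint: "X \<inter> Y = {}"
    and Z: "\<And>y. y \<in> partite c Y \<Longrightarrow> card y \<le> 3 \<Longrightarrow> Z y \<subseteq> multisets_of_size X (3 - card y)"
begin

abbreviation "\<O> \<equiv> cubic_ideal X c Y Z"

lemma finite_partite: "y \<in> partite c Y \<Longrightarrow> finite y"
  using finite_Y finite_subset by (auto simp: partite_def)

lemma partite_subset: "y \<in> partite c Y \<Longrightarrow> z \<subseteq> y \<Longrightarrow> z \<in> partite c Y"
  by (auto simp: partite_def inj_on_subset)

lemma low_degree_in_ideal:
  "y \<in> partite c Y \<Longrightarrow> set_mset m \<subseteq> X \<Longrightarrow> card y + size m \<le> 2 \<Longrightarrow> mset_set y + m \<in> \<O>"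
  unfolding cubic_ideal_def by blast

lemma cubic_in_ideal:
  "y \<in> partite c Y \<Longrightarrow> card y \<le> 3 \<Longrightarrow> m \<in> Z y \<Longrightarrow> mset_set y + m \<in> \<O>"
  using Z unfolding cubic_ideal_def multisets_of_size_def by blast

lemma in_idealE:
  assumes "\<mu> \<in> \<O>"
  obtains y m where "\<mu> = mset_set y + m" "y \<in> partite c Y" "set_mset m \<subseteq> X" "size \<mu> = card y + size m"
    "size \<mu> \<le> 2 \<or> (size \<mu> = 3 \<and> m \<in> Z y)"
proof -
  obtain y m where ym: "\<mu> = mset_set y + m" "y \<in> partite c Y" "set_mset m \<subseteq> X"
    "card y + size m \<le> 2 \<or> (card y \<le> 3 \<and> m \<in> Z y)"
    using assms unfolding cubic_ideal_def by blast
  have "size m = 3 - card y" if "card y \<le> 3" "m \<in> Z y"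
    using Z[OF ym(2) that(1)] that(2) by (auto simp: multisets_of_size_def)
  then have "size \<mu> \<le> 2 \<or> (size \<mu> = 3 \<and> m \<in> Z y)" using ym(1,4) by auto
  then show ?thesis using that[OF ym(1-3)] ym(1) by simp
qed

lemma order_ideal: "order_ideal 3 \<O>"
  unfolding order_ideal_def
proof (intro conjI ballI allI impI)
  have "mset_set {} + {#} \<in> \<O>" by (rule low_degree_in_ideal) (auto simp: partite_def)
  then show "\<O> \<noteq> {}" by blast
  have "(\<Union>\<mu>\<in>\<O>. set_mset \<mu>) \<subseteq> X \<union> Y"
  proof
    fix v assume "v \<in> (\<Union>\<mu>\<in>\<O>. set_mset \<mu>)"
    then obtain \<mu> where "\<mu> \<in> \<O>" "v \<in># \<mu>" by blast
    then obtain y m where "v \<in># mset_set y + m" "y \<in> partite c Y" "set_mset m \<subseteq> X"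
      by (metis in_idealE)
    then show "v \<in> X \<union> Y" using finite_partite[of y] by (auto simp: partite_def)
  qed
  then show "finite (\<Union>\<mu>\<in>\<O>. set_mset \<mu>)" using finite_X finite_Y finite_subset by blast
  fix \<mu> assume \<mu>: "\<mu> \<in> \<O>"
  then show sz: "size \<mu> \<le> 3" by (elim in_idealE) auto
  fix \<nu> assume \<nu>: "\<nu> \<subseteq># \<mu>"
  show "\<nu> \<in> \<O>"
  proof (cases "\<nu> = \<mu>")
    case False
    then have "size \<nu> < size \<mu>" using \<nu> by (simp add: mset_subset_size subset_mset.less_le)
    then have sz\<nu>: "size \<nu> \<le> 2" using sz by linarith
    obtain y m where ym: "\<mu> = mset_set y + m" "y \<in> partite c Y" "set_mset m \<subseteq> X"
      using in_idealE[OF \<mu>] by blast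
    obtain A B where AB: "\<nu> = A + B" "A \<subseteq># mset_set y" "B \<subseteq># m"
      using subset_mset_plusD \<nu> ym(1) by blast
    obtain z where z: "z \<subseteq> y" "A = mset_set z"
      using subset_mset_setD[OF AB(2) finite_partite[OF ym(2)]] by blast
    have "mset_set z + B \<in> \<O>"
    proof (rule low_degree_in_ideal)
      show "z \<in> partite c Y" using partite_subset ym(2) z(1) .
      show "set_mset B \<subseteq> X" using AB(3) ym(3) set_mset_mono by fastforce
      show "card z + size B \<le> 2" using sz\<nu> AB(1) z(2) by simp
    qed
    then show ?thesis using AB z by simp
  qed (use \<mu> in simp)
qed

lemma degree_count_eq_sum:
  assumes "j \<le> 3"
  shows "degree_count \<O> j = (\<Sum>y\<in>{y \<in> partite c Y. card y \<le> j}.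
    card (if j = 3 then Z y else multisets_of_size X (j - card y)))"
proof -
  let ?W = "\<lambda>y. if j = 3 then Z y else multisets_of_size X (j - card y)"
  let ?S = "Sigma {y \<in> partite c Y. card y \<le> j} ?W"
  let ?h = "\<lambda>(y, m). mset_set y + m"
  have W: "set_mset m \<subseteq> X" "size m = j - card y" if "y \<in> partite c Y" "card y \<le> j" "m \<in> ?W y" for y m
    using that Z[of y] by (auto simp: multisets_of_size_def split: if_splits)
  have "{\<mu> \<in> \<O>. size \<mu> = j} = ?h ` ?S"
  proof
    show "{\<mu> \<in> \<O>. size \<mu> = j} \<subseteq> ?h ` ?S"
    proof
      fix \<mu> assume "\<mu> \<in> {\<mu> \<in> \<O>. size \<mu> = j}"
      then have \<mu>: "\<mu> \<in> \<O>" "size \<mu> = j" by auto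
      obtain y m where ym: "\<mu> = mset_set y + m" "y \<in> partite c Y" "set_mset m \<subseteq> X"
        "size \<mu> = card y + size m" "size \<mu> \<le> 2 \<or> (size \<mu> = 3 \<and> m \<in> Z y)"
        using in_idealE[OF \<mu>(1)] by blast
      then have "(y, m) \<in> ?S" using \<mu>(2) by (auto simp: multisets_of_size_def)
      then show "\<mu> \<in> ?h ` ?S" using ym(1) by force
    qed
    show "?h ` ?S \<subseteq> {\<mu> \<in> \<O>. size \<mu> = j}"
    proof
      fix \<mu> assume "\<mu> \<in> ?h ` ?S"
      then obtain y m where ym: "y \<in> partite c Y" "card y \<le> j" "m \<in> ?W y" "\<mu> = mset_set y + m"
        by auto
      have "mset_set y + m \<in> \<O>"
        using ym W[OF ym(1-3)] low_degree_in_ideal[OF ym(1), of m] cubic_in_ideal[OF ym(1), of m] assms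
        by (cases "j = 3") auto
      then show "\<mu> \<in> {\<mu> \<in> \<O>. size \<mu> = j}" using ym W[OF ym(1-3)] by simp
    qed
  qed
  moreover have "inj_on ?h ?S"
  proof (rule inj_on_inverseI)
    fix p assume "p \<in> ?S"
    then obtain y m where p: "p = (y, m)" "y \<in> partite c Y" "card y \<le> j" "m \<in> ?W y" by auto
    have y: "finite y" "y \<subseteq> Y" using p(2) finite_partite by (auto simp: partite_def)
    have mX: "set_mset m \<subseteq> X" using W[OF p(2-4)] by simp
    have "filter_mset (\<lambda>v. v \<in> X) (mset_set y) = {#}"
    proof -
      have "\<forall>v\<in>y. v \<notin> X" using y(2) disjoint by auto
      then show ?thesis using y(1) by (simp add: multiset_eq_iff count_mset_set')
    qed
    moreover have "filter_mset (\<lambda>v. v \<in> X) m = m" using mX by (auto simp: filter_mset_eq_conv)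
    moreover have "set_mset (mset_set y + m) \<inter> Y = y" using y mX disjoint by auto
    ultimately show "(\<lambda>\<mu>. (set_mset \<mu> \<inter> Y, filter_mset (\<lambda>v. v \<in> X) \<mu>)) (?h p) = p" using p by simp
  qed
  ultimately have "degree_count \<O> j = card ?S"
    by (simp only: degree_count_def card_image)
  also have "\<dots> = (\<Sum>y\<in>{y \<in> partite c Y. card y \<le> j}. card (?W y))"
  proof (rule card_SigmaI)
    have "partite c Y \<subseteq> Pow Y" by (auto simp: partite_def)
    then show "finite {y \<in> partite c Y. card y \<le> j}" using finite_Y finite_subset by fastforce
    show "\<forall>y\<in>{y \<in> partite c Y. card y \<le> j}. finite (?W y)"
      using Z finite_X by (auto intro: finite_subset[OF Z] finite_multisets_of_size)
  qed
  finally show ?thesis .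
qed

lemma low_degree_extends:
  assumes "x \<in> X" "\<mu> \<in> \<O>" "size \<mu> \<le> 1"
  shows "add_mset x \<mu> \<in> \<O>"
proof -
  obtain y m where ym: "\<mu> = mset_set y + m" "y \<in> partite c Y" "set_mset m \<subseteq> X" "size \<mu> = card y + size m"
    using in_idealE[OF assms(2)] by blast
  then have "mset_set y + add_mset x m \<in> \<O>" using assms by (intro low_degree_in_ideal) auto
  then show ?thesis using ym(1) by simp
qed

lemma pure_degree_3:
  assumes "x \<in> X"
    and cover: "\<And>y m. y \<in> partite c Y \<Longrightarrow> card y \<le> 2 \<Longrightarrow> m \<in> multisets_of_size X (2 - card y) \<Longrightarrow>
      \<exists>\<nu>\<in>\<O>. mset_set y + m \<subset># \<nu>"
  shows "pure \<O>"
proof -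
  have "size \<mu> = 3" if \<mu>: "maximal_monomial \<O> \<mu>" for \<mu>
  proof -
    have \<mu>\<O>: "\<mu> \<in> \<O>" and max: "\<And>\<nu>. \<nu> \<in> \<O> \<Longrightarrow> \<mu> \<subseteq># \<nu> \<Longrightarrow> \<nu> = \<mu>"
      using \<mu> by (auto simp: maximal_monomial_def)
    obtain y m where ym: "\<mu> = mset_set y + m" "y \<in> partite c Y" "set_mset m \<subseteq> X"
      "size \<mu> = card y + size m" "size \<mu> \<le> 2 \<or> (size \<mu> = 3 \<and> m \<in> Z y)"
      using in_idealE[OF \<mu>\<O>] by blast
    have "\<not> size \<mu> \<le> 1"
      using low_degree_extends[OF assms(1) \<mu>\<O>] max[of "add_mset x \<mu>"] by auto
    moreover have "size \<mu> \<noteq> 2"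
    proof
      assume "size \<mu> = 2"
      then have "m \<in> multisets_of_size X (2 - card y)" "card y \<le> 2"
        using ym by (auto simp: multisets_of_size_def)
      then obtain \<nu> where "\<nu> \<in> \<O>" "\<mu> \<subset># \<nu>" using cover ym by blast
      then show False using max[of \<nu>] by (simp add: subset_mset.less_le)
    qed
    ultimately show ?thesis using ym(5) by linarith
  qed
  then show ?thesis by (simp add: pure_def)
qed

lemma pure_degree_2:
  assumes "x \<in> X" and "\<And>y. y \<in> partite c Y \<Longrightarrow> card y \<le> 3 \<Longrightarrow> Z y = {}"
  shows "pure \<O>"
proof -
  have "size \<mu> = 2" if \<mu>: "maximal_monomial \<O> \<mu>" for \<mu>
  proof -
    have \<mu>\<O>: "\<mu> \<in> \<O>" and max: "\<And>\<nu>. \<nu> \<in> \<O> \<Longrightarrow> \<mu> \<subseteq># \<nu> \<Longrightarrow> \<nu> = \<mu>"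
      using \<mu> by (auto simp: maximal_monomial_def)
    obtain y m where ym: "\<mu> = mset_set y + m" "y \<in> partite c Y" "size \<mu> = card y + size m"
      "size \<mu> \<le> 2 \<or> (size \<mu> = 3 \<and> m \<in> Z y)"
      using in_idealE[OF \<mu>\<O>] by blast
    have "\<not> size \<mu> \<le> 1"
      using low_degree_extends[OF assms(1) \<mu>\<O>] max[of "add_mset x \<mu>"] by auto
    moreover have "size \<mu> \<noteq> 3" using assms(2)[OF ym(2)] ym(3,4) by auto
    ultimately show ?thesis using ym(4) by linarith
  qed
  then show ?thesis by (simp add: pure_def)
qed

text \<open>
A maximal monomial whose degree is smaller than that of another monomial misses a colour class of the latter,
from which it can be extended.
\<close>

lemma pure_partite:
  assumes X: "X = {}" and full: "\<And>y. y \<in> partite c Y \<Longrightarrow> card y = 3 \<Longrightarrow> Z y = {{#}}"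
  shows "pure \<O>"
proof -
  have form: "\<exists>y. \<mu> = mset_set y \<and> y \<in> partite c Y \<and> size \<mu> = card y \<and> card y \<le> 3" if "\<mu> \<in> \<O>" for \<mu>
    using that by (elim in_idealE) (auto simp: X)
  have mem: "mset_set y \<in> \<O>" if "y \<in> partite c Y" "card y \<le> 3" for y
    using low_degree_in_ideal[OF that(1), of "{#}"] cubic_in_ideal[OF that, of "{#}"] full[OF that(1)] that(2)
    by (cases "card y = 3") auto
  have le: "size \<nu> \<le> size \<mu>" if \<mu>: "maximal_monomial \<O> \<mu>" and \<nu>: "\<nu> \<in> \<O>" for \<mu> \<nu>
  proof (rule ccontr)
    assume less: "\<not> size \<nu> \<le> size \<mu>"
    obtain y where y: "\<mu> = mset_set y" "y \<in> partite c Y" "size \<mu> = card y" "card y \<le> 3"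
      using form \<mu> by (auto simp: maximal_monomial_def)
    obtain z where z: "\<nu> = mset_set z" "z \<in> partite c Y" "size \<nu> = card z" "card z \<le> 3"
      using form \<nu> by blast
    have fin: "finite y" "finite z" using y z finite_partite by auto
    have "card (c ` y) < card (c ` z)"
      using less y z by (simp add: partite_def card_image)
    then have "\<not> c ` z \<subseteq> c ` y" using fin by (meson card_mono finite_imageI linorder_not_le)
    then obtain v where v: "v \<in> z" "c v \<notin> c ` y" by blast
    have "insert v y \<in> partite c Y" using v y(2) z(2) by (auto simp: partite_def)
    moreover have "v \<notin> y" using v by blast
    ultimately have "mset_set (insert v y) \<in> \<O>" using fin less y z by (intro mem) auto
    then have "add_mset v \<mu> \<in> \<O>" using fin \<open>v \<notin> y\<close> y by simp
    then show False using \<mu> unfolding maximal_monomial_def by fastforce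
  qed
  show ?thesis unfolding pure_def
    using le by (auto simp: maximal_monomial_def intro!: antisym)
qed

end

text \<open>
Multiplication by a fixed variable \<open>x\<close> covers every monomial of degree \<open>n\<close>. If \<open>n > 0\<close> and there is a second variable \<open>w\<close>,
the product with \<open>x ^ n\<close> can be saved, as \<open>x ^ n\<close> also divides \<open>x\<close> times \<open>w x ^ (n - 1)\<close>.
\<close>

lemma small_cover:
  assumes X: "finite X" "X \<noteq> {}"
  obtains C where "C \<subseteq> multisets_of_size X (Suc n)"
    "card C + (if card X \<ge> 2 \<and> n \<ge> 1 then 1 else 0) \<le> card (multisets_of_size X n)"
    "\<And>m. m \<in> multisets_of_size X n \<Longrightarrow> \<exists>z\<in>C. m \<subset># z"
proof -
  obtain x where x: "x \<in> X" using X by blast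
  have fin: "finite (multisets_of_size X n)" using X by (simp add: finite_multisets_of_size)
  show ?thesis
  proof (cases "card X \<ge> 2 \<and> n \<ge> 1")
    case False
    have "card (add_mset x ` multisets_of_size X n) \<le> card (multisets_of_size X n)"
      using fin by (rule card_image_le)
    then show ?thesis
      using x False by (intro that[of "add_mset x ` multisets_of_size X n"]) (auto simp: multisets_of_size_def)
  next
    case True
    then have "\<not> X \<subseteq> {x}" using card_mono[of "{x}" X] by auto
    then obtain w where w: "w \<in> X" "w \<noteq> x" by blast
    let ?p = "replicate_mset n x"
    let ?C = "add_mset x ` (multisets_of_size X n - {?p})"
    have p: "?p \<in> multisets_of_size X n" using x by (auto simp: multisets_of_size_def)
    have "card ?C \<le> card (multisets_of_size X n - {?p})" using fin by (intro card_image_le) simp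
    moreover have "card (multisets_of_size X n) = Suc (card (multisets_of_size X n - {?p}))"
      using fin p by (rule card.remove)
    ultimately have card: "card ?C + 1 \<le> card (multisets_of_size X n)" by simp
    have cover: "\<exists>z\<in>?C. m \<subset># z" if "m \<in> multisets_of_size X n" for m
    proof (cases "m = ?p")
      case False
      then show ?thesis using that by (intro bexI[of _ "add_mset x m"]) auto
    next
      case eq: True
      obtain n' where n: "n = Suc n'" using True by (cases n) auto
      let ?q = "add_mset w (replicate_mset n' x)"
      have "?q \<in> multisets_of_size X n" using w x n by (auto simp: multisets_of_size_def)
      moreover have "?q \<noteq> ?p"
      proof
        assume "?q = ?p"
        then have "w \<in># ?p" by (metis union_single_eq_member add_mset_add_single union_commute)
        then show False using w(2) by (simp split: if_splits)
      qed
      ultimately have "add_mset x ?q \<in> ?C" by blast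
      moreover have "m \<subset># add_mset x ?q" using eq n by (simp add: add_mset_commute)
      ultimately show ?thesis by blast
    qed
    show ?thesis
      by (rule that[OF _ _ cover]) (use card True x in \<open>auto simp: multisets_of_size_def\<close>)
  qed
qed

section \<open>Choosing the cubic monomials\<close>

context loopless_matroid
begin

text \<open>
The degree counts of the order ideal and the entries of the \<open>h\<close>-vector are sums over the same partial
transversals and agree term by term, so it remains to choose \<open>Z\<close> so that purity holds.
\<close>

lemma pure_O_sequence_from_cubics:
  assumes k: "card (reps E I) = rank I + k" and "3 \<le> rank I"
    and X: "X \<subseteq> reps E I" "card X = k"
    and cubics: "\<And>y. y \<in> partial_transversals \<Longrightarrow> card y \<le> 3 \<Longrightarrow>
      Z y \<subseteq> multisets_of_size X (3 - card y) \<and>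
      card (Z y) + card (dep_triples (reps E I) simple_indeps (rep E I ` y))
        = (k + (3 - card y) - 1) choose (3 - card y)"
    and pure: "pure (cubic_ideal X (rep E I) (E - reps E I) Z)"
  shows "pure_O_sequence [1, h_vec I 1, h_vec I 2, h_vec I 3]"
proof -
  let ?Y = "E - reps E I" and ?c = "rep E I"
  have finX: "finite X" using X(1) reps_subset finite_ground by (meson finite_subset)
  interpret cubic_ideal_data X ?Y ?c Z
    using cubics X finX finite_ground by unfold_locales auto
  have count: "h_vec I j = int (degree_count \<O> j)" if "j \<le> 3" for j
    unfolding degree_count_eq_sum[OF that] of_nat_sum
      h_vec_eq_sum_transversals[OF k that le_trans[OF that \<open>3 \<le> rank I\<close>]]
  proof (rule sum.cong[OF refl])
    fix y assume "y \<in> {y \<in> partial_transversals. card y \<le> j}"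
    then show "int (k + (j - card y) - 1 choose (j - card y))
        - (if j = 3 then int (card (dep_triples (reps E I) simple_indeps (?c ` y))) else 0)
      = int (card (if j = 3 then Z y else multisets_of_size X (j - card y)))"
      using cubics[of y] that X(2) finX
      by (cases "j = 3") (auto simp: card_multisets_of_size simp flip: of_nat_add)
  qed
  have "{\<mu> \<in> \<O>. size \<mu> = 0} = {{#}}"
    using low_degree_in_ideal[of "{}" "{#}"] by (auto simp: partite_def)
  then have "degree_count \<O> 0 = 1" by (simp add: degree_count_def)
  then have "[1, h_vec I 1, h_vec I 2, h_vec I 3] ! i = int (degree_count \<O> i)" if "i < 4" for i
    using that count by (auto simp: less_Suc_eq numeral_eq_Suc)
  then show ?thesis
    using order_ideal pure by (intro pure_O_sequenceI[of _ \<O>]) (simp_all add: numeral_eq_Suc)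
qed

text \<open>
The dependent triples are those of the line \<open>L\<close>. If the representatives of \<open>z\<close> lie on \<open>L\<close>, they are contained
in as many triples of \<open>L\<close> as there are monomials of degree \<open>3 - card z\<close> in \<open>k\<close> variables, which forces \<open>Z z\<close>
to be empty; otherwise \<open>Z z\<close> has to contain all of these monomials.
\<close>

lemma pure_O_sequence_long_line:
  assumes k: "card (reps E I) = rank I + k" and "3 \<le> rank I" "1 \<le> k"
    and X: "X \<subseteq> reps E I" "card X = k"
    and xy: "x \<in> reps E I" "y \<in> reps E I" "x \<noteq> y"
    and L: "k + 2 \<le> card (line (reps E I) simple_indeps x y)"
  shows "pure_O_sequence [1, h_vec I 1, h_vec I 2, h_vec I 3]"
proof -
  let ?P = "reps E I" and ?c = "rep E I" and ?Y = "E - reps E I"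
  interpret S: simple_matroid ?P simple_indeps by (rule simple_matroid_reps)
  define L where "L = line ?P simple_indeps x y"
  have rkS: "card ?P = rank simple_indeps + k" using k rank_simple_indeps by simp
  note long = S.long_line[OF xy rkS L, folded L_def]
  have finL: "finite L" "L \<subseteq> ?P" using S.finite_line S.line_subset by (auto simp: L_def)
  have finX: "finite X" using X(1) reps_subset finite_ground by (meson finite_subset)
  obtain a where a: "a \<in> X" using X(2) \<open>1 \<le> k\<close> by (cases "X = {}") auto
  define Z where "Z z = (if ?c ` z \<subseteq> L then {} else multisets_of_size X (3 - card z))" for z
  have dep: "dep_triples ?P simple_indeps R = {T. R \<subseteq> T \<and> T \<subseteq> L \<and> card T = 3}" for R
    using long(2) finL(2) by (auto simp: dep_triples_def)
  have cubics: "Z z \<subseteq> multisets_of_size X (3 - card z) \<and>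
      card (Z z) + card (dep_triples ?P simple_indeps (?c ` z)) = (k + (3 - card z) - 1) choose (3 - card z)"
    if z: "z \<in> partial_transversals" "card z \<le> 3" for z
  proof (cases "?c ` z \<subseteq> L")
    case True
    have "card (?c ` z) = card z" using z(1) by (auto simp: partite_def card_image)
    then have "card (dep_triples ?P simple_indeps (?c ` z)) = (k + 2 - card z) choose (3 - card z)"
      unfolding dep using card_supersets[OF finL(1) True, of 3] z(2) long(1) by simp
    moreover have "k + 2 - card z = k + (3 - card z) - 1" using z(2) \<open>1 \<le> k\<close> by linarith
    ultimately show ?thesis using True by (simp add: Z_def)
  next
    case False
    then have "dep_triples ?P simple_indeps (?c ` z) = {}" unfolding dep by blast
    then show ?thesis using False X finX by (simp add: Z_def card_multisets_of_size)
  qed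
  interpret cubic_ideal_data X ?Y ?c Z
    using cubics X finX finite_ground by unfold_locales auto
  have "pure \<O>"
  proof (cases "\<exists>v\<in>?Y. ?c v \<notin> L")
    case True
    then obtain v where v: "v \<in> ?Y" "?c v \<notin> L" by blast
    show ?thesis
    proof (rule pure_degree_3[OF a])
      fix z m assume z: "z \<in> partite ?c ?Y" "card z \<le> 2" and m: "m \<in> multisets_of_size X (2 - card z)"
      show "\<exists>\<nu>\<in>\<O>. mset_set z + m \<subset># \<nu>"
      proof (cases "?c ` z \<subseteq> L")
        case True
        have vz: "insert v z \<in> partite ?c ?Y" "v \<notin> z" using z(1) v True by (auto simp: partite_def)
        have fin: "finite z" using finite_partite z(1) .
        have "\<not> ?c ` insert v z \<subseteq> L" using v by simp
        then have "m \<in> Z (insert v z)" using m fin vz(2) z(2) by (simp add: Z_def)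
        then have "mset_set (insert v z) + m \<in> \<O>" using vz fin z(2) by (intro cubic_in_ideal) auto
        moreover have "mset_set z + m \<subset># mset_set (insert v z) + m" using fin vz by simp
        ultimately show ?thesis by blast
      next
        case False
        have "add_mset a m \<in> Z z" using m a False z(2) by (auto simp: Z_def multisets_of_size_def)
        then have "mset_set z + add_mset a m \<in> \<O>" using z by (intro cubic_in_ideal) auto
        moreover have "mset_set z + m \<subset># mset_set z + add_mset a m" by simp
        ultimately show ?thesis by blast
      qed
    qed
  next
    case False
    have "?c ` z \<subseteq> L" if "z \<in> partite ?c ?Y" for z
      using that False by (auto simp: partite_def)
    then have "Z z = {}" if "z \<in> partite ?c ?Y" for z using that by (simp add: Z_def)
    then show ?thesis using pure_degree_2[OF a] by blast
  qed
  then show ?thesis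
    using pure_O_sequence_from_cubics[OF k \<open>3 \<le> rank I\<close> X cubics] by blast
qed

text \<open>
By Pascal's rule, subtracting the bound on dependent triples from the number of monomials of degree
\<open>3 - card z\<close> leaves at least the size of the cover of the monomials of degree \<open>2 - card z\<close> from
\<open>small_cover\<close>, so \<open>Z z\<close> can be chosen to contain that cover.
\<close>

lemma pure_O_sequence_short_lines:
  assumes k: "card (reps E I) = rank I + k" and "3 \<le> rank I" "1 \<le> k"
    and X: "X \<subseteq> reps E I" "card X = k"
    and short: "\<And>x y. x \<in> reps E I \<Longrightarrow> y \<in> reps E I \<Longrightarrow> x \<noteq> y \<Longrightarrow>
      card (line (reps E I) simple_indeps x y) \<le> k + 1"
  shows "pure_O_sequence [1, h_vec I 1, h_vec I 2, h_vec I 3]"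
proof -
  let ?P = "reps E I" and ?c = "rep E I" and ?Y = "E - reps E I"
  let ?D = "\<lambda>z. card (dep_triples ?P simple_indeps (?c ` z))"
  interpret S: simple_matroid ?P simple_indeps by (rule simple_matroid_reps)
  have rkS: "card ?P = rank simple_indeps + k" using k rank_simple_indeps by simp
  have finX: "finite X" using X(1) reps_subset finite_ground by (meson finite_subset)
  obtain a where a: "a \<in> X" using X(2) \<open>1 \<le> k\<close> by (cases "X = {}") auto
  have "\<exists>W. W \<subseteq> multisets_of_size X (3 - card z) \<and>
      card W + ?D z = ((k + (3 - card z) - 1) choose (3 - card z)) \<and>
      (card z \<le> 2 \<longrightarrow> (\<forall>m\<in>multisets_of_size X (2 - card z). \<exists>w\<in>W. m \<subset># w))"
    if z: "z \<in> partial_transversals" "card z \<le> 3" for z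
  proof -
    have cz: "card (?c ` z) = card z" using z(1) by (auto simp: partite_def card_image)
    let ?M = "multisets_of_size X (3 - card z)"
    have M: "card ?M = ((k + (3 - card z) - 1) choose (3 - card z))" "finite ?M"
      using X finX by (simp_all add: card_multisets_of_size finite_multisets_of_size)
    \<comment> \<open>\<open>C\<close> is the set of cofactors needed for purity; it is enlarged to the required size below.\<close>
    obtain C where C: "C \<subseteq> ?M" "card C + ?D z \<le> card ?M"
      "card z \<le> 2 \<longrightarrow> (\<forall>m\<in>multisets_of_size X (2 - card z). \<exists>w\<in>C. m \<subset># w)"
    proof (cases "card z \<le> 2")
      case True
      obtain n where n: "n = 2 - card z" "Suc n = 3 - card z" using True by simp
      obtain C where C: "C \<subseteq> multisets_of_size X (Suc n)"
        "card C + (if card X \<ge> 2 \<and> n \<ge> 1 then 1 else 0) \<le> card (multisets_of_size X n)"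
        "\<And>m. m \<in> multisets_of_size X n \<Longrightarrow> \<exists>w\<in>C. m \<subset># w"
        using small_cover[OF finX] a by blast
      have ineq: "k + 1 - card z = k + n - 1" "1 \<le> n \<longleftrightarrow> card z \<le> 1" using n True \<open>1 \<le> k\<close> by linarith+
      have "?D z \<le> ((k + n - 1) choose Suc n) + (if k \<ge> 2 \<and> n \<ge> 1 then 1 else 0)"
        using S.card_dep_triples_containing[OF rkS short rep_image_subset[OF z(1)]] True
        unfolding cz ineq n(2) by simp
      moreover have "card (multisets_of_size X n) = ((k + n - 1) choose n)"
        using X finX by (simp add: card_multisets_of_size)
      moreover have "card ?M = ((k + n - 1) choose Suc n) + ((k + n - 1) choose n)"
      proof -
        have "k + Suc n - 1 = Suc (k + n - 1)" using \<open>1 \<le> k\<close> by simp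
        then have "(k + Suc n - 1) choose Suc n = ((k + n - 1) choose Suc n) + ((k + n - 1) choose n)"
          by (simp only: binomial_Suc_Suc add.commute)
        then show ?thesis using M(1) unfolding n(2)[symmetric] by (simp only:)
      qed
      ultimately have "card C + ?D z \<le> card ?M" using C(2) X(2) by (simp split: if_splits)
      then show ?thesis using that C n by auto
    next
      case False
      then have z3: "card z = 3" using z(2) by simp
      have "T = ?c ` z" if "?c ` z \<subseteq> T" "card T = 3" for T
        using card_subset_eq[of T "?c ` z"] that cz z3 by (simp add: card_ge_0_finite)
      then have "dep_triples ?P simple_indeps (?c ` z) \<subseteq> {?c ` z}"
        unfolding dep_triples_def by blast
      then have "?D z \<le> card {?c ` z}" by (intro card_mono) auto
      then show ?thesis using that[of "{}"] z3 by simp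
    qed
    have "card C \<le> card ?M - ?D z" using C(2) by linarith
    from exists_subset_between[OF this _ C(1) M(2)] obtain W where
      W: "C \<subseteq> W" "W \<subseteq> ?M" "card W = card ?M - ?D z" by auto
    show ?thesis
    proof (intro exI[of _ W] conjI impI ballI)
      show "W \<subseteq> ?M" by (rule W(2))
      show "card W + ?D z = ((k + (3 - card z) - 1) choose (3 - card z))"
        using W(3) C(2) unfolding M(1) by linarith
      fix m assume "card z \<le> 2" "m \<in> multisets_of_size X (2 - card z)"
      then obtain w where "w \<in> C" "m \<subset># w" using C(3) by auto
      then show "\<exists>w\<in>W. m \<subset># w" using W(1) by auto
    qed
  qed
  then obtain Z where cubics: "\<And>z. z \<in> partial_transversals \<Longrightarrow> card z \<le> 3 \<Longrightarrow>
      Z z \<subseteq> multisets_of_size X (3 - card z) \<and>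
      card (Z z) + ?D z = ((k + (3 - card z) - 1) choose (3 - card z)) \<and>
      (card z \<le> 2 \<longrightarrow> (\<forall>m\<in>multisets_of_size X (2 - card z). \<exists>w\<in>Z z. m \<subset># w))"
    by metis
  interpret cubic_ideal_data X ?Y ?c Z
    using cubics X finX finite_ground by unfold_locales auto
  have "pure \<O>"
  proof (rule pure_degree_3[OF a])
    fix z m assume z: "z \<in> partite ?c ?Y" "card z \<le> 2" and m: "m \<in> multisets_of_size X (2 - card z)"
    then obtain w where w: "w \<in> Z z" "m \<subset># w" using cubics[of z] by auto
    then have "mset_set z + w \<in> \<O>" using z by (intro cubic_in_ideal) auto
    moreover have "mset_set z + m \<subset># mset_set z + w" using w(2) by simp
    ultimately show "\<exists>\<nu>\<in>\<O>. mset_set z + m \<subset># \<nu>" by (rule bexI[rotated])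
  qed
  then show ?thesis
    using pure_O_sequence_from_cubics[OF k \<open>3 \<le> rank I\<close> X, of Z] cubics by blast
qed

text \<open>
The representatives form a basis, so there are no dependent triples and no variables \<open>X\<close>. The monomials are the
partial transversals of size at most 3.
\<close>

lemma pure_O_sequence_free:
  assumes k: "card (reps E I) = rank I" and "3 \<le> rank I"
  shows "pure_O_sequence [1, h_vec I 1, h_vec I 2, h_vec I 3]"
proof -
  let ?P = "reps E I" and ?c = "rep E I" and ?Y = "E - reps E I"
  obtain B where B: "B \<in> I" "B \<subseteq> ?P" "card B = rank I" by (rule basis_in_reps)
  have "finite ?P" using finite_ground reps_subset finite_subset by blast
  then have "B = ?P" using B k by (intro card_subset_eq) auto
  then have dep: "dep_triples ?P simple_indeps R = {}" for R
    using B(1) indep_subset by (auto simp: dep_triples_def simple_indeps_def)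
  define Z :: "'a set \<Rightarrow> 'a multiset set" where "Z z = multisets_of_size {} (3 - card z)" for z
  interpret cubic_ideal_data "{}" ?Y ?c Z
    using finite_ground by unfold_locales (auto simp: Z_def)
  have "pure \<O>" by (rule pure_partite) (simp_all add: Z_def)
  then show ?thesis
    using \<open>3 \<le> rank I\<close> k
    by (intro pure_O_sequence_from_cubics[of 0 "{}" Z]) (simp_all add: Z_def dep card_multisets_of_size)
qed

end

theorem theorem4p1:
  fixes E :: "'a set" and I :: "'a set set" and d :: nat
  assumes "matroid E I"
    and "loopless E I"
    and "rank I = d"
    and "d \<ge> 3"
  shows "pure_O_sequence [1, h_vec I 1, h_vec I 2, h_vec I 3]"
proof -
  interpret matroid E I by fact
  interpret loopless_matroid E I
    using assms(2) by unfold_locales (auto simp: loopless_def is_loop_def)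
  obtain B where B: "B \<in> I" "B \<subseteq> reps E I" "card B = rank I" by (rule basis_in_reps)
  have fin: "finite (reps E I)" using finite_ground reps_subset finite_subset by blast
  obtain k where k: "card (reps E I) = rank I + k"
    using card_mono[OF fin B(2)] B(3) le_Suc_ex by metis
  have X: "reps E I - B \<subseteq> reps E I" "card (reps E I - B) = k"
    using B k finite_indep[OF B(1)] by (auto simp: card_Diff_subset)
  have d: "3 \<le> rank I" using assms by simp
  consider "k = 0" | "1 \<le> k" "\<forall>x\<in>reps E I. \<forall>y\<in>reps E I. x \<noteq> y \<longrightarrow>
      card (line (reps E I) simple_indeps x y) \<le> k + 1"
    | x y where "1 \<le> k" "x \<in> reps E I" "y \<in> reps E I" "x \<noteq> y"
      "k + 2 \<le> card (line (reps E I) simple_indeps x y)"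
    by (force simp: not_le)
  then show ?thesis
  proof cases
    case 1
    then show ?thesis using pure_O_sequence_free k d by simp
  next
    case 2
    then show ?thesis using pure_O_sequence_short_lines[OF k d _ X] by blast
  next
    case 3
    then show ?thesis using pure_O_sequence_long_line[OF k d _ X] by blast
  qed
qed

end
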